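(* Suppose either $t=1$, $k\ge35$ and $n\ge2k+5$, or $1<t\le\frac k4-2$ and $n\ge2k+14t$. Then every non-trivial intersecting family $\mathcal F\subseteq\binom{[n]}{k}$ satisfies $\delta_t(\mathcal F)\le\binom{n-t-1}{k-t-1}-\binom{n-t-k-1}{k-t-1}$.
   Context: A family is intersecting if any two of its sets intersect, and non-trivial if no element belongs to all of its sets. For $\mathcal F\subseteq\binom{[n]}{k}$ and $S\subseteq[n]$, the degree of $S$ is the number of sets of $\mathcal F$ containing $S$; $\delta_t(\mathcal F)$ is the minimum degree of a $t$-element subset $S\subseteq[n]$. *)

theory Defs
  imports Complex_Main "HOL-Library.Ramsey"
begin

definition intersecting :: "'a set set \<Rightarrow> bool" where
  "intersecting F \<longleftrightarrow> (\<forall>A\<in>F. \<forall>B\<in>F. A \<inter> B \<noteq> {})"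

definition non_trivial :: "'a set set \<Rightarrow> bool" where
  "non_trivial F \<longleftrightarrow> \<not> (\<exists>x. \<forall>A\<in>F. x \<in> A)"

definition set_degree :: "'a set set \<Rightarrow> 'a set \<Rightarrow> nat" where
  "set_degree F S = card {A \<in> F. S \<subseteq> A}"

(* Meaningful for t \<le> n only: otherwise [n] has no t-element subset and Min is taken over
   the empty set. *)
definition min_degree :: "nat \<Rightarrow> nat \<Rightarrow> nat set set \<Rightarrow> nat" where
  "min_degree n t F = Min (set_degree F ` nsets {1..n} t)"

end

theory Submission
  imports Defs
begin

text \<open>Fix a point \<open>x\<close>. Averaging the degrees of the \<open>t\<close>-sets avoiding \<open>x\<close> contradicts a large
  minimum degree as soon as the number \<open>M\<close> of \<open>(k - 1)\<close>-sets missing from the link of \<open>x\<close> clearly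
  exceeds the diversity \<open>\<gamma>\<close>, the number of members of \<open>F\<close> avoiding \<open>x\<close>. Since all sets disjoint
  from a member avoiding \<open>x\<close> are missing, Kruskal--Katona gives \<open>(k - 1) M \<ge> (n - k - 1) \<gamma>\<close> whenever
  \<open>\<gamma> \<le> (n - 3) choose (k - 2)\<close>, and this suffices unless \<open>\<gamma>\<close> is tiny; then a \<open>t\<close>-set disjoint from
  two members avoiding \<open>x\<close> has small degree. Hence every point has diversity at least
  \<open>(n - 3) choose (k - 2)\<close>, which forces \<open>F\<close> to be so small that averaging over all \<open>t\<close>-sets is
  enough. For this last bound one shifts \<open>F\<close> as long as all diversities stay large. A shifted family
  satisfies the same linear inequality by Katona's intersecting shadow argument, and if the shift
  from \<open>j\<close> to \<open>i\<close> makes the diversity of \<open>i\<close> drop, then few members avoid both points and the bound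
  follows from the four traces on \<open>{i, j}\<close>.\<close>

section \<open>Shifting and shadows\<close>

text \<open>Averaging at \<open>x\<close> needs \<open>M - k / (k - t) * \<gamma>\<close> to be at
  least \<open>N\<close> times the quotient of \<open>(n - 1) choose t\<close> by
  \<open>(k - 1) choose t\<close>, where \<open>N\<close> is the binomial subtracted in the bound. A
  single member avoiding \<open>x\<close> guarantees only
  \<open>M \<ge> (n - k - 1) choose (k - 1)\<close>, too little by a factor bounded by
  \<open>(1 + k / (n - k - t)) ^ t\<close>. Raising the top of this binomial by
  \<open>2 * t + 2\<close> makes up for it: for \<open>t \<ge> 2\<close> any two of the growth
  factors outweigh one of the \<open>t\<close> factors, and the last two pay for the share of
  \<open>\<gamma>\<close>. So averaging starts to work at
  \<open>\<gamma> = (n - k + 2 * t + 1) choose (2 * t + 2)\<close>, and the direct construction of a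
  \<open>t\<close>-set of small degree has to reach that far. The upper threshold
  \<open>(n - 3) choose (k - 2)\<close> is the diversity, at a point of a fixed triple, of the
  family of all \<open>k\<close>-sets meeting that triple in two or more points. There the linear
  inequality is an equality. For larger \<open>\<gamma>\<close> Kruskal--Katona at a single point
  gives worse ratios, so the large diversities of all points have to be used together.\<close>

definition shift :: "'a \<Rightarrow> 'a \<Rightarrow> 'a set set \<Rightarrow> 'a set \<Rightarrow> 'a set" where
  "shift i j F A = (if j \<in> A \<and> i \<notin> A \<and> insert i (A - {j}) \<notin> F then insert i (A - {j}) else A)"

definition shift_family :: "'a \<Rightarrow> 'a \<Rightarrow> 'a set set \<Rightarrow> 'a set set" where
  "shift_family i j F = shift i j F ` F"

lemma swap_back: "i \<noteq> j \<Longrightarrow> j \<in> A \<Longrightarrow> i \<notin> A \<Longrightarrow> insert j (insert i (A - {j}) - {i}) = A"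
  by auto

text \<open>A set moves only if its image is not yet in \<open>F\<close>, so a moved set cannot
  collide with an unmoved one; two moved sets with the same image coincide because the move can be
  undone.\<close>

lemma inj_on_shift:
  assumes "i \<noteq> j"
  shows "inj_on (shift i j F) F"
proof (rule inj_onI)
  fix A B assume AB: "A \<in> F" "B \<in> F" and eq: "shift i j F A = shift i j F B"
  consider "shift i j F A = A" "shift i j F B = B" | "shift i j F A \<notin> F" "shift i j F B = B"
    | "shift i j F A = A" "shift i j F B \<notin> F"
    | "j \<in> A" "i \<notin> A" "j \<in> B" "i \<notin> B" "insert i (A - {j}) = insert i (B - {j})"
    using eq unfolding shift_def by presburger
  then show "A = B"
  proof cases
    case 4
    have "A = insert j (insert i (A - {j}) - {i})" using swap_back[OF assms 4(1,2)] by simp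
    also have "\<dots> = insert j (insert i (B - {j}) - {i})" by (simp only: 4(5))
    also have "\<dots> = B" using swap_back[OF assms 4(3,4)] .
    finally show ?thesis .
  next
    case 1
    then show ?thesis using eq by metis
  next
    case 2
    then show ?thesis using AB eq by metis
  next
    case 3
    then show ?thesis using AB eq by metis
  qed
qed

lemma card_shift_family: "i \<noteq> j \<Longrightarrow> card (shift_family i j F) = card F"
  unfolding shift_family_def by (rule card_image[OF inj_on_shift])

lemma finite_shift_family: "finite F \<Longrightarrow> finite (shift_family i j F)"
  unfolding shift_family_def by simp

lemma in_shift_family_iff:
  assumes "i \<noteq> j"
  shows "B \<in> shift_family i j F \<longleftrightarrow>
    (B \<in> F \<and> (j \<in> B \<and> i \<notin> B \<longrightarrow> insert i (B - {j}) \<in> F)) \<or>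
    (i \<in> B \<and> j \<notin> B \<and> B \<notin> F \<and> insert j (B - {i}) \<in> F)" (is "_ \<longleftrightarrow> ?P \<or> ?Q")
proof
  assume "B \<in> shift_family i j F"
  then obtain A where A: "A \<in> F" "B = shift i j F A" unfolding shift_family_def by auto
  show "?P \<or> ?Q"
  proof (cases "j \<in> A \<and> i \<notin> A \<and> insert i (A - {j}) \<notin> F")
    case True
    then have B: "B = insert i (A - {j})" using A unfolding shift_def by simp
    then have "insert j (B - {i}) = A" using swap_back[OF assms] True by simp
    then show ?thesis using True A(1) assms B by simp
  next
    case False
    then have "B = A" using A unfolding shift_def by (simp only: if_False)
    then show ?thesis using A False by auto
  qed
next
  assume "?P \<or> ?Q"
  then show "B \<in> shift_family i j F"
  proof
    assume ?P
    then have "shift i j F B = B" unfolding shift_def by auto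
    then show ?thesis using \<open>?P\<close> unfolding shift_family_def by (metis imageI)
  next
    assume Q: ?Q
    let ?A = "insert j (B - {i})"
    have "insert i (?A - {j}) = B" using Q assms by auto
    then have "shift i j F ?A = B" using Q assms unfolding shift_def by auto
    then show ?thesis using Q unfolding shift_family_def by (metis imageI)
  qed
qed

lemma card_swap:
  assumes "j \<in> A" "i \<notin> A"
  shows "card (insert i (A - {j})) = card A"
proof (cases "finite A")
  case True
  then show ?thesis using assms card_Suc_Diff1[of A j] by simp
next
  case False
  then show ?thesis by simp
qed

section \<open>Shadows at an arbitrary level and their behaviour under shifting\<close>

definition shadow_at :: "nat \<Rightarrow> 'a set set \<Rightarrow> 'a set set" where
  "shadow_at l F = {D. finite D \<and> card D = l \<and> (\<exists>A\<in>F. D \<subseteq> A)}"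

lemma finite_shadow_at:
  assumes "finite F" "\<And>A. A \<in> F \<Longrightarrow> finite A"
  shows "finite (shadow_at l F)"
proof (rule finite_subset)
  show "shadow_at l F \<subseteq> Pow (\<Union>F)" unfolding shadow_at_def by auto
  show "finite (Pow (\<Union>F))" using assms by simp
qed

lemma shadow_at_mono: "F \<subseteq> F' \<Longrightarrow> shadow_at l F \<subseteq> shadow_at l F'"
  unfolding shadow_at_def by blast

lemma shadow_at_same:
  assumes "\<And>A. A \<in> F \<Longrightarrow> finite A \<and> card A = a"
  shows "shadow_at a F = F"
proof
  show "shadow_at a F \<subseteq> F"
  proof
    fix D assume "D \<in> shadow_at a F"
    then obtain A where "A \<in> F" "D \<subseteq> A" "card D = a" unfolding shadow_at_def by auto
    then show "D \<in> F" using assms[of A] card_subset_eq[of A D] by simp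
  qed
  show "F \<subseteq> shadow_at a F" using assms unfolding shadow_at_def by auto
qed

text \<open>Exchanging \<open>i\<close> and \<open>j\<close> preserves inclusions. The delicate case
  is \<open>j \<in> D\<close>, \<open>i \<notin> D\<close>: a member of the shifted family above
  \<open>D\<close> still contains \<open>j\<close>, so it was not moved, and then the exchanged copy
  of \<open>D\<close> lies in the shadow of \<open>F\<close> as well.\<close>

lemma shadow_shift_family:
  assumes "i \<noteq> j"
  shows "shadow_at l (shift_family i j F) \<subseteq> shift_family i j (shadow_at l F)"
proof
  fix D assume "D \<in> shadow_at l (shift_family i j F)"
  then obtain B where D: "finite D" "card D = l" "D \<subseteq> B" and B: "B \<in> shift_family i j F"
    unfolding shadow_at_def by auto
  note B' = B[unfolded in_shift_family_iff[OF assms]]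
  have sh: "E \<in> shadow_at l F" if "E \<subseteq> A" "A \<in> F" "finite E" "card E = l" for E A
    using that unfolding shadow_at_def by auto
  consider (i) "i \<in> D" "j \<notin> D" | (j) "j \<in> D" "i \<notin> D" | (ij) "i \<in> D" "j \<in> D" | (no) "i \<notin> D" "j \<notin> D"
    by blast
  then show "D \<in> shift_family i j (shadow_at l F)"
  proof cases
    case i
    show ?thesis
    proof (cases "B \<in> F")
      case True
      then have "D \<in> shadow_at l F" using sh D by blast
      then show ?thesis using i in_shift_family_iff[OF assms] by blast
    next
      case False
      then have "insert j (B - {i}) \<in> F" using B' by blast
      then have "insert j (D - {i}) \<in> shadow_at l F"
        using D i card_swap[of i D j] by (intro sh[of _ "insert j (B - {i})"]) auto
      then show ?thesis using i in_shift_family_iff[OF assms, of D] by blast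
    qed
  next
    case j
    then have BF: "B \<in> F" and Bi: "i \<notin> B \<longrightarrow> insert i (B - {j}) \<in> F" using B' D by auto
    have "D \<in> shadow_at l F" using BF sh D by blast
    moreover have "insert i (D - {j}) \<in> shadow_at l F"
    proof (cases "i \<in> B")
      case True
      then show ?thesis using BF D j card_swap[of j D i] by (intro sh[of _ B]) auto
    next
      case False
      then show ?thesis using Bi D j card_swap[of j D i]
        by (intro sh[of _ "insert i (B - {j})"]) auto
    qed
    ultimately show ?thesis using in_shift_family_iff[OF assms, of D] by blast
  next
    case ij
    then have "D \<in> shadow_at l F" using B' D sh by blast
    then show ?thesis using ij in_shift_family_iff[OF assms, of D] by blast
  next
    case no
    have "D \<in> shadow_at l F"
    proof (cases "B \<in> F")
      case True
      then show ?thesis using D sh by blast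
    next
      case False
      then have "insert j (B - {i}) \<in> F" using B' by blast
      then show ?thesis using D no by (intro sh[of _ "insert j (B - {i})"]) auto
    qed
    then show ?thesis using no in_shift_family_iff[OF assms, of D] by blast
  qed
qed

lemma card_shadow_shift_family:
  assumes "i \<noteq> j" "finite F" "\<And>A. A \<in> F \<Longrightarrow> finite A"
  shows "card (shadow_at l (shift_family i j F)) \<le> card (shadow_at l F)"
proof -
  have "finite (shadow_at l F)" using assms(2,3) by (rule finite_shadow_at)
  then have "card (shadow_at l (shift_family i j F)) \<le> card (shift_family i j (shadow_at l F))"
    by (intro card_mono finite_shift_family shadow_shift_family assms(1))
  then show ?thesis by (simp only: card_shift_family[OF assms(1)])
qed

lemma shift_family_uniform:
  assumes "i \<noteq> j" "\<And>A. A \<in> F \<Longrightarrow> finite A \<and> card A = a" "B \<in> shift_family i j F"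
  shows "finite B \<and> card B = a"
proof -
  obtain A where "A \<in> F" "B = shift i j F A" using assms(3) unfolding shift_family_def by auto
  then show ?thesis using assms(2)[of A] card_swap[of j A i] unfolding shift_def
    by (auto split: if_splits)
qed

text \<open>Only shifts towards the single point \<open>v\<close> are iterated. Each one that
  changes the family turns a member avoiding \<open>v\<close> into one containing it, so the number
  of members avoiding \<open>v\<close> decreases and the process stops.\<close>

lemma exists_compressed:
  fixes v :: 'a and F :: "'a set set"
  assumes "finite F" "\<And>A. A \<in> F \<Longrightarrow> finite A \<and> card A = a"
  shows "\<exists>F'. finite F' \<and> card F' = card F \<and> (\<forall>A\<in>F'. finite A \<and> card A = a) \<and>
    (\<forall>l. card (shadow_at l F') \<le> card (shadow_at l F)) \<and>
    (\<forall>A\<in>F'. \<forall>x\<in>A. v \<notin> A \<longrightarrow> insert v (A - {x}) \<in> F')"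
  using assms
proof (induction "card {A \<in> F. v \<notin> A}" arbitrary: F rule: less_induct)
  case less
  show ?case
  proof (cases "\<forall>A\<in>F. \<forall>x\<in>A. v \<notin> A \<longrightarrow> insert v (A - {x}) \<in> F")
    case True
    then show ?thesis using less.prems by blast
  next
    case False
    then obtain A x where A: "A \<in> F" "x \<in> A" "v \<notin> A" "insert v (A - {x}) \<notin> F" by blast
    then have vx: "v \<noteq> x" by auto
    let ?G = "shift_family v x F"
    have "{B \<in> ?G. v \<notin> B} \<subseteq> {B \<in> F. v \<notin> B} - {A}"
      using in_shift_family_iff[OF vx] A by auto
    also have "\<dots> \<subset> {B \<in> F. v \<notin> B}" using A by auto
    finally have "card {B \<in> ?G. v \<notin> B} < card {B \<in> F. v \<notin> B}"
      using less.prems by (intro psubset_card_mono) auto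
    then obtain F' where F': "finite F'" "card F' = card ?G" "\<forall>A\<in>F'. finite A \<and> card A = a"
      "\<forall>l. card (shadow_at l F') \<le> card (shadow_at l ?G)"
      "\<forall>A\<in>F'. \<forall>x\<in>A. v \<notin> A \<longrightarrow> insert v (A - {x}) \<in> F'"
      using less.hyps[of ?G] finite_shift_family[OF less.prems(1)]
        shift_family_uniform[OF vx less.prems(2)] by blast
    have "card (shadow_at l F') \<le> card (shadow_at l F)" for l
      using F'(4) card_shadow_shift_family[OF vx less.prems(1)] less.prems(2)
      by (meson order_trans)
    then show ?thesis using F' card_shift_family[OF vx, of F] by metis
  qed
qed

text \<open>A form of the Kruskal--Katona theorem that needs neither cascades nor real binomial coefficients.\<close>

lemma shadow_lower_bound:
  assumes "finite F" "\<And>A. A \<in> F \<Longrightarrow> finite A \<and> card A = a" "l \<le> a" "a \<le> m"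
    "card F \<le> m choose a"
  shows "card F * (m choose l) \<le> card (shadow_at l F) * (m choose a)"
  using assms
proof (induction m arbitrary: a l F)
  case 0
  then show ?case using shadow_at_same[of F a] by auto
next
  case (Suc m)
  note fin = Suc.prems(1) and unif = Suc.prems(2)
  \<comment> \<open>A family that is too large for the induction hypothesis is cut down to exactly
    \<open>m choose b\<close> members, where the bound reads \<open>m choose l'\<close>.\<close>
  have ge: "(m choose l') \<le> card (shadow_at l' G)"
    if g: "finite G" "\<And>A. A \<in> G \<Longrightarrow> finite A \<and> card A = b" "l' \<le> b" "b \<le> m" "m choose b \<le> card G"
    for G :: "'a set set" and b l'
  proof -
    obtain G' where G': "G' \<subseteq> G" "card G' = m choose b"
      using g(5) obtain_subset_with_card_n by metis
    have finG': "finite G'" using G' that finite_subset by blast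
    have "card G' * (m choose l') \<le> card (shadow_at l' G') * (m choose b)"
      using that G' finG' by (intro Suc.IH) auto
    then have "m choose l' \<le> card (shadow_at l' G')"
      using G' that(4) by (simp add: mult.commute)
    also have "\<dots> \<le> card (shadow_at l' G)"
      using that G' by (intro card_mono finite_shadow_at shadow_at_mono) auto
    finally show ?thesis .
  qed
  consider "l = a" | "l = 0" "l < a" | "F = {}" | "a = Suc m" "F \<noteq> {}"
    | "l < a" "0 < l" "a \<le> m" "F \<noteq> {}"
    using Suc.prems by linarith
  then show ?case
  proof cases
    case 1
    then show ?thesis using shadow_at_same[of F a] Suc.prems by auto
  next
    case 2
    show ?thesis
    proof (cases "F = {}")
      case False
      then have "shadow_at l F = {{}}" using 2 unfolding shadow_at_def by auto
      then show ?thesis using Suc.prems 2 by simp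
    qed simp
  next
    case 3
    then show ?thesis by simp
  next
    case 4
    then have "card F = 1" using Suc.prems by (simp add: card_gt_0_iff le_Suc_eq)
    then obtain A where A: "F = {A}" by (auto simp: card_1_singleton_iff)
    then have "shadow_at l F = {D. D \<subseteq> A \<and> card D = l}"
      using unif[of A] unfolding shadow_at_def by (auto intro: finite_subset)
    then have "card (shadow_at l F) = Suc m choose l"
      using n_subsets[of A l] unif[of A] A 4 by simp
    then show ?thesis using A 4 by simp
  next
    case 5
    obtain A0 where "A0 \<in> F" using 5 by auto
    then have "A0 \<noteq> {}" using unif[of A0] 5 by auto
    then obtain v where "v \<in> A0" by auto
    have "\<exists>G. finite G \<and> card G = card F \<and> (\<forall>A\<in>G. finite A \<and> card A = a) \<and>
      (\<forall>l. card (shadow_at l G) \<le> card (shadow_at l F)) \<and>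
      (\<forall>A\<in>G. \<forall>x\<in>A. v \<notin> A \<longrightarrow> insert v (A - {x}) \<in> G)"
      by (rule exists_compressed) (use fin unif in auto)
    then obtain G where "finite G \<and> card G = card F \<and> (\<forall>A\<in>G. finite A \<and> card A = a) \<and>
      (\<forall>l. card (shadow_at l G) \<le> card (shadow_at l F)) \<and>
      (\<forall>A\<in>G. \<forall>x\<in>A. v \<notin> A \<longrightarrow> insert v (A - {x}) \<in> G)"
      by (elim exE)
    then have G: "finite G" "card G = card F" "\<And>A. A \<in> G \<Longrightarrow> finite A \<and> card A = a"
      "card (shadow_at l G) \<le> card (shadow_at l F)"
      "\<And>A x. A \<in> G \<Longrightarrow> x \<in> A \<Longrightarrow> v \<notin> A \<Longrightarrow> insert v (A - {x}) \<in> G"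
      by simp_all
    obtain a' l' where al: "a = Suc a'" "l = Suc l'" using 5 by (metis less_nat_zero_code not0_implies_Suc)
    define G0 where "G0 = {A \<in> G. v \<notin> A}"
    define G1 where "G1 = (\<lambda>A. A - {v}) ` {A \<in> G. v \<in> A}"
    have fin01: "finite G0" "finite G1" using G(1) by (auto simp: G0_def G1_def)
    have inj: "inj_on (\<lambda>A. A - {v}) {A \<in> G. v \<in> A}"
      by (rule inj_onI) (metis (lifting) insert_Diff mem_Collect_eq)
    have un0: "finite A \<and> card A = a" if "A \<in> G0" for A using that G(3) by (auto simp: G0_def)
    have un1: "finite A \<and> card A = a'" if "A \<in> G1" for A using that G(3) al by (auto simp: G1_def)
    have G1v: "v \<notin> A" and G1i: "insert v A \<in> G" if "A \<in> G1" for A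
      using that by (auto simp: G1_def insert_absorb)
    have "G = G0 \<union> {A \<in> G. v \<in> A}" by (auto simp: G0_def)
    then have "card G = card G0 + card {A \<in> G. v \<in> A}"
      using card_Un_disjoint[of G0 "{A \<in> G. v \<in> A}"] G(1) fin01 by (auto simp: G0_def)
    then have cardG: "card F = card G0 + card G1" using G(2) card_image[OF inj] by (simp add: G1_def)
    \<comment> \<open>This is the gain from compression: a member avoiding \<open>v\<close> may
      exchange any of its points for \<open>v\<close>, so deleting that point leaves a set of the
      link \<open>G1\<close>.\<close>
    have "shadow_at a' G0 \<subseteq> G1"
    proof
      fix D assume "D \<in> shadow_at a' G0"
      then obtain A where A: "A \<in> G" "v \<notin> A" "D \<subseteq> A" "finite D" "card D = a'"
        unfolding shadow_at_def G0_def by auto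
      then have "card (A - D) = 1" using G(3)[of A] al by (simp add: card_Diff_subset)
      then obtain x where x: "A - D = {x}" by (auto simp: card_1_singleton_iff)
      then have "D = A - {x}" "x \<in> A" using A by auto
      then have "insert v D \<in> G" using G(5) A by blast
      moreover have "D = insert v D - {v}" using A by auto
      ultimately show "D \<in> G1" unfolding G1_def by blast
    qed
    then have sh0: "card (shadow_at a' G0) \<le> card G1" using fin01 by (intro card_mono) auto
    have vsh: "v \<notin> D" if "D \<in> shadow_at k G1" for D k
      using that G1v unfolding shadow_at_def by auto
    have fsh: "finite (shadow_at k G1)" for k using fin01 un1 by (intro finite_shadow_at) auto
    \<comment> \<open>Below the members through \<open>v\<close>, the shadow splits into sets with
      and without \<open>v\<close>; the two levels \<open>l'\<close> and \<open>l\<close> of the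
      link match Pascal's rule for \<open>Suc m choose l\<close>.\<close>
    have "insert v ` shadow_at l' G1 \<union> shadow_at l G1 \<subseteq> shadow_at l G"
    proof (rule Un_least; rule subsetI)
      fix E assume "E \<in> insert v ` shadow_at l' G1"
      then obtain D A where E: "E = insert v D" "finite D" "card D = l'" "D \<subseteq> A" "A \<in> G1"
        unfolding shadow_at_def by auto
      then have "v \<notin> D" "insert v A \<in> G" "E \<subseteq> insert v A" using G1i G1v by auto
      then show "E \<in> shadow_at l G" using E al unfolding shadow_at_def by auto
    next
      fix E assume "E \<in> shadow_at l G1"
      then obtain A where E: "finite E" "card E = l" "E \<subseteq> A" "A \<in> G1"
        unfolding shadow_at_def by auto
      then have "E \<subseteq> insert v A" "insert v A \<in> G" using G1i by auto
      then show "E \<in> shadow_at l G" using E unfolding shadow_at_def by blast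
    qed
    then have "card (insert v ` shadow_at l' G1 \<union> shadow_at l G1) \<le> card (shadow_at l G)"
      using G by (intro card_mono finite_shadow_at) auto
    moreover have "card (insert v ` shadow_at l' G1 \<union> shadow_at l G1)
        = card (insert v ` shadow_at l' G1) + card (shadow_at l G1)"
      using fsh vsh by (intro card_Un_disjoint) auto
    moreover have "card (insert v ` shadow_at l' G1) = card (shadow_at l' G1)"
      using vsh by (intro card_image inj_onI) (metis Diff_insert_absorb)
    ultimately have sh: "card (shadow_at l' G1) + card (shadow_at l G1) \<le> card (shadow_at l F)"
      using G(4) by linarith
    have pos: "0 < m choose a'" using 5 al by simp
    show ?thesis
    proof (cases "m choose a' \<le> card G1")
      case True
      have "(m choose l') + (m choose l) \<le> card (shadow_at l' G1) + card (shadow_at l G1)"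
        using fin01 un1 5 al True by (intro add_mono ge) auto
      then have "Suc m choose l \<le> card (shadow_at l F)" using sh al by simp
      then show ?thesis using Suc.prems(5) by (metis mult.commute mult_le_mono)
    next
      case False
      \<comment> \<open>Otherwise the shadow of \<open>G0\<close> would already fill
        \<open>m choose a'\<close> places inside \<open>G1\<close>. The induction hypothesis for
        \<open>G0\<close> at level \<open>a'\<close> then bounds \<open>card F\<close> by a multiple
        of \<open>card G1\<close>, so that only the link remains to be estimated.\<close>
      have "card G0 < m choose a"
      proof (rule ccontr)
        assume "\<not> card G0 < m choose a"
        then have "m choose a' \<le> card (shadow_at a' G0)"
          using fin01 un0 5 al by (intro ge[of G0 a]) auto
        then show False using sh0 False by linarith
      qed
      then have "card G0 * (m choose a') \<le> card (shadow_at a' G0) * (m choose a)"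
        using fin01 un0 5 al by (intro Suc.IH) auto
      also have "\<dots> \<le> card G1 * (m choose a)" using sh0 by simp
      finally have "card F * (m choose a') \<le> card G1 * (Suc m choose a)"
        using cardG al by (simp add: algebra_simps)
      then have 1: "card F * (m choose a') * (Suc m choose l) \<le> card G1 * (Suc m choose a) * (Suc m choose l)"
        by (rule mult_le_mono1)
      have "card G1 * (m choose l') \<le> card (shadow_at l' G1) * (m choose a')"
        using fin01 un1 5 al False by (intro Suc.IH) auto
      moreover have "card G1 * (m choose l) \<le> card (shadow_at l G1) * (m choose a')"
        using fin01 un1 5 al False by (intro Suc.IH) auto
      ultimately have "card G1 * (Suc m choose l) \<le> (card (shadow_at l' G1) + card (shadow_at l G1)) * (m choose a')"
        using al by (simp add: algebra_simps)
      also have "\<dots> \<le> card (shadow_at l F) * (m choose a')" using sh by simp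
      finally have "card G1 * (Suc m choose l) * (Suc m choose a) \<le> card (shadow_at l F) * (m choose a') * (Suc m choose a)"
        by (rule mult_le_mono1)
      then have "card G1 * (Suc m choose a) * (Suc m choose l)
          \<le> card (shadow_at l F) * (m choose a') * (Suc m choose a)"
        by (simp only: mult_ac)
      from order_trans[OF 1 this]
      have "(m choose a') * (card F * (Suc m choose l))
          \<le> (m choose a') * (card (shadow_at l F) * (Suc m choose a))"
        by (simp only: mult_ac)
      then show ?thesis using pos by (simp only: mult_le_cancel1)
    qed
  qed
qed

section \<open>Cross-intersecting families\<close>

text \<open>An \<open>l\<close>-subset of the complement of a member of \<open>G\<close> is disjoint
  from that member, hence not in \<open>H\<close>: the level-\<open>l\<close> shadow of the
  complements and \<open>H\<close> share the \<open>N choose l\<close> available sets. The free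
  parameter \<open>m\<close> calibrates the Kruskal--Katona bound. Up to
  \<open>m choose (N - k)\<close> members the bound is linear in \<open>card G\<close>; from there
  on the value \<open>m choose l\<close> is kept.\<close>

lemma cross_intersecting_bounds:
  assumes X: "finite X" "card X = N"
    and G: "\<And>A. A \<in> G \<Longrightarrow> A \<subseteq> X \<and> card A = k"
    and H: "\<And>B. B \<in> H \<Longrightarrow> B \<subseteq> X \<and> card B = l"
    and cross: "\<And>A B. A \<in> G \<Longrightarrow> B \<in> H \<Longrightarrow> A \<inter> B \<noteq> {}"
    and kl: "k + l \<le> N" and m: "N - k \<le> m"
  shows "card G \<le> m choose (N - k) \<Longrightarrow>
      card G * (m choose l) + card H * (m choose (N - k)) \<le> (N choose l) * (m choose (N - k))"
    and "m choose (N - k) \<le> card G \<Longrightarrow> (m choose l) + card H \<le> N choose l"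
proof -
  have main: "card G' * (m choose l) + card H * (m choose (N - k)) \<le> (N choose l) * (m choose (N - k))"
    if G': "G' \<subseteq> G" "card G' \<le> m choose (N - k)" for G'
  proof -
    let ?A = "(\<lambda>A. X - A) ` G'"
    have sub: "G' \<subseteq> Pow X" using G G' by auto
    have fin: "finite G'" using sub X finite_subset by blast
    have inj: "inj_on (\<lambda>A. X - A) G'" using sub by (intro inj_onI) blast
    have un: "finite A \<and> card A = N - k" if "A \<in> ?A" for A
    proof -
      obtain B where "B \<in> G" "A = X - B" using \<open>A \<in> ?A\<close> G' by auto
      then show ?thesis using G[of B] X by (metis card_Diff_subset finite_Diff finite_subset)
    qed
    have "card ?A * (m choose l) \<le> card (shadow_at l ?A) * (m choose (N - k))"
      using fin un kl m that card_image[OF inj] by (intro shadow_lower_bound) auto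
    then have 1: "card G' * (m choose l) \<le> card (shadow_at l ?A) * (m choose (N - k))"
      using card_image[OF inj] by simp
    have disj: "shadow_at l ?A \<inter> H = {}"
      using cross G' unfolding shadow_at_def by blast
    have sub2: "shadow_at l ?A \<union> H \<subseteq> {B. B \<subseteq> X \<and> card B = l}"
      using H unfolding shadow_at_def by auto
    have fin2: "finite {B. B \<subseteq> X \<and> card B = l}" using X by simp
    have "card (shadow_at l ?A) + card H = card (shadow_at l ?A \<union> H)"
      using disj sub2 fin2 finite_subset by (intro card_Un_disjoint[symmetric]) auto
    also have "\<dots> \<le> N choose l" using card_mono[OF fin2 sub2] n_subsets[OF X(1)] X(2) by simp
    finally have "card (shadow_at l ?A) + card H \<le> N choose l" .
    then have "(card (shadow_at l ?A) + card H) * (m choose (N - k)) \<le> (N choose l) * (m choose (N - k))"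
      by (rule mult_le_mono1)
    then show ?thesis using 1 by (simp add: add_mult_distrib)
  qed
  then show "card G \<le> m choose (N - k) \<Longrightarrow>
      card G * (m choose l) + card H * (m choose (N - k)) \<le> (N choose l) * (m choose (N - k))"
    by blast
  show "(m choose l) + card H \<le> N choose l" if le: "m choose (N - k) \<le> card G"
  proof -
    obtain G' where G': "G' \<subseteq> G" "card G' = m choose (N - k)"
      using le obtain_subset_with_card_n by metis
    have "(m choose (N - k)) * ((m choose l) + card H) \<le> (m choose (N - k)) * (N choose l)"
      using main[OF G'(1)] G'(2) by (simp add: algebra_simps)
    then show ?thesis using m by simp
  qed
qed

section \<open>Shifted intersecting families\<close>

text \<open>The condition \<open>1 \<le> i\<close> keeps the new element inside
  \<open>{1..n}\<close>, since \<open>0\<close> is a natural number too.\<close>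

definition shifted :: "nat set set \<Rightarrow> bool" where
  "shifted F \<longleftrightarrow> (\<forall>A\<in>F. \<forall>i j. 1 \<le> i \<longrightarrow> i < j \<longrightarrow> j \<in> A \<longrightarrow> i \<notin> A \<longrightarrow> insert i (A - {j}) \<in> F)"

lemma card_Int_atLeastAtMost_Suc:
  "card (A \<inter> {1..Suc z}) = card (A \<inter> {1..z}) + (if Suc z \<in> A then 1 else 0)"
proof -
  have "A \<inter> {1..Suc z} = (if Suc z \<in> A then insert (Suc z) (A \<inter> {1..z}) else A \<inter> {1..z})"
    by (auto simp: le_Suc_eq)
  then show ?thesis by simp
qed

lemma card_split_at:
  fixes A :: "nat set"
  assumes "A \<subseteq> {1..n}"
  shows "card A = card (A \<inter> {1..z}) + card (A \<inter> {z<..})"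
proof -
  have fin: "finite A" using assms finite_subset by blast
  have "A = (A \<inter> {1..z}) \<union> (A \<inter> {z<..})" using assms by auto
  then have "card A = card ((A \<inter> {1..z}) \<union> (A \<inter> {z<..}))" by simp
  also have "\<dots> = card (A \<inter> {1..z}) + card (A \<inter> {z<..})"
    using fin by (intro card_Un_disjoint) auto
  finally show ?thesis .
qed

text \<open>Otherwise every element of \<open>A\<close> could be moved to a free smaller place, giving a member of
  the family disjoint from \<open>A\<close>.\<close>

lemma shifted_prefix_majority:
  assumes F: "F \<subseteq> nsets {1..n} k" "intersecting F" "shifted F" and A: "A \<in> F"
  shows "\<exists>z. z < 2 * card (A \<inter> {1..z})"
proof (rule ccontr)
  assume "\<nexists>z. z < 2 * card (A \<inter> {1..z})"
  then have small: "2 * card (A \<inter> {1..z}) \<le> z" for z by (meson not_le)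
  have sub: "B \<subseteq> {1..n}" "card B = k" if "B \<in> F" for B
    using that F(1) by (auto simp: nsets_def)
  \<comment> \<open>Invariant: up to \<open>z\<close> the elements of \<open>A\<close> have been
    replaced, beyond \<open>z\<close> nothing has changed. At \<open>z = n\<close> this is a member
    disjoint from \<open>A\<close>.\<close>
  have "\<exists>B\<in>F. B \<inter> A \<inter> {1..z} = {} \<and> B \<inter> {z<..} = A \<inter> {z<..}" for z
  proof (induction z)
    case 0
    then show ?case using A by (intro bexI[of _ A]) auto
  next
    case (Suc z)
    then obtain B where B: "B \<in> F" "B \<inter> A \<inter> {1..z} = {}" "B \<inter> {z<..} = A \<inter> {z<..}" by blast
    show ?case
    proof (cases "Suc z \<in> A")
      case False
      have "B \<inter> A \<inter> {1..Suc z} = {}" using B(2) False by (auto simp: le_Suc_eq)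
      moreover have "B \<inter> {Suc z<..} = A \<inter> {Suc z<..}" using B(3) by fastforce
      ultimately show ?thesis using B(1) by blast
    next
      case True
      then have SB: "Suc z \<in> B" using B(3) by (metis IntD1 IntI greaterThan_iff lessI)
      have "card (B \<inter> {1..z}) = card (A \<inter> {1..z})"
        using card_split_at[OF sub(1)[OF B(1)], of z] card_split_at[OF sub(1)[OF A], of z]
          sub(2)[OF B(1)] sub(2)[OF A] B(3) by simp
      \<comment> \<open>\<open>A\<close> and \<open>B\<close> have equally many elements up to
        \<open>z\<close>, and \<open>small\<close> at \<open>Suc z\<close> allows at most
        \<open>z - 1\<close> of them altogether, so some place is free of both.\<close>
      then have "card ((A \<inter> {1..z}) \<union> (B \<inter> {1..z})) < card {1..z}"
        using card_Un_le[of "A \<inter> {1..z}" "B \<inter> {1..z}"] small[of "Suc z"] True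
          card_Int_atLeastAtMost_Suc[of A z] by simp
      moreover have "card {1..z} \<le> card ((A \<inter> {1..z}) \<union> (B \<inter> {1..z}))" if "{1..z} \<subseteq> A \<union> B"
        using that by (intro card_mono) auto
      ultimately obtain y where y: "y \<in> {1..z}" "y \<notin> A" "y \<notin> B" by force
      let ?B = "insert y (B - {Suc z})"
      have "?B \<in> F" using F(3) B(1) SB y unfolding shifted_def by auto
      moreover have "?B \<inter> A \<inter> {1..Suc z} = {}" using B(2) y by (auto simp: le_Suc_eq)
      moreover have "?B \<inter> {Suc z<..} = A \<inter> {Suc z<..}"
      proof -
        have "?B \<inter> {Suc z<..} = B \<inter> {z<..} \<inter> {Suc z<..}" using y by auto
        also have "\<dots> = A \<inter> {Suc z<..}" unfolding B(3) by auto
        finally show ?thesis .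
      qed
      ultimately show ?thesis by blast
    qed
  qed
  then obtain B where "B \<in> F" "B \<inter> A \<inter> {1..n} = {}" by blast
  then have "B \<in> F" "B \<inter> A = {}" using sub(1) by blast+
  then show False using F(2) A unfolding intersecting_def by blast
qed

text \<open>Double counting: \<open>A\<close> is cut at the first \<open>z\<close> such that more than half of \<open>{1..z}\<close> lies in \<open>A\<close>,
  and \<open>R A D\<close> holds if \<open>D\<close> complements \<open>A\<close> below the cut and is disjoint from it above. The cut can
  be recovered from \<open>D\<close>, so all \<open>A\<close> related to a given \<open>D\<close> carry the same weight.\<close>

lemma shifted_diversity_bound:
  assumes F: "F \<subseteq> nsets {1..n} k" "intersecting F" "shifted F" and nk: "2 * k < n" "2 \<le> k"
  shows "real (n - k - 1) * card {A \<in> F. 1 \<notin> A} + real (k - 1) * card {A \<in> F. 1 \<in> A}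
    \<le> real (k - 1) * ((n - 1) choose (k - 1))"
proof -
  define G where "G = {A \<in> F. 1 \<notin> A}"
  define M where "M = {D \<in> nsets {2..n} (k - 1). insert 1 D \<notin> F}"
  define z where "z A = (LEAST z. z < 2 * card (A \<inter> {1..z}))" for A :: "nat set"
  define c where "c A = card (A \<inter> {1..z A})" for A
  define R where "R A D \<longleftrightarrow> D \<inter> A = {} \<and> D \<inter> {1..z A} = {2..z A} - A" for A D
  \<comment> \<open>The reciprocal of the guaranteed number of partners \<open>D\<close> of
    \<open>A\<close>, so that every member of \<open>G\<close> receives total weight at least
    1.\<close>
  define w where "w A = 1 / real ((n - k + 1 - c A) choose (k + 1 - c A))" for A
  have finM: "finite M" unfolding M_def by (simp add: finite_imp_finite_nsets)
  have finF: "finite F" using F(1) finite_subset finite_imp_finite_nsets by blast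
  then have finG: "finite G" unfolding G_def by simp
  have sub: "A \<subseteq> {1..n}" "card A = k" "finite A" if "A \<in> F" for A
    using that F(1) by (auto simp: nsets_def)
  have GA: "A \<in> F" "1 \<notin> A" if "A \<in> G" for A using that by (auto simp: G_def)
  have z1: "z A < 2 * c A" if "A \<in> G" for A
    unfolding z_def c_def by (rule LeastI_ex) (rule shifted_prefix_majority[OF F GA(1)[OF that]])
  have zle: "z A \<le> y" if "y < 2 * card (A \<inter> {1..y})" for A y
    unfolding z_def using that by (rule Least_le)
  \<comment> \<open>By minimality of the cut, the majority there is won by a single element.\<close>
  have z2: "z A + 1 = 2 * c A" if "A \<in> G" for A
  proof (cases "z A")
    case 0
    then show ?thesis using z1[OF that] by (simp add: c_def)
  next
    case (Suc y)
    then have "\<not> y < 2 * card (A \<inter> {1..y})" using zle[of y A] by auto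
    then show ?thesis using z1[OF that] card_Int_atLeastAtMost_Suc[of A y] Suc
      by (auto simp: c_def split: if_splits)
  qed
  \<comment> \<open>The value 1 would mean a cut at 1, that is, \<open>1 \<in> A\<close>.\<close>
  have c2: "2 \<le> c A" if "A \<in> G" for A
  proof (rule ccontr)
    assume "\<not> 2 \<le> c A"
    then have c1: "c A = 1" using z2[OF that] by arith
    then have "z A = 1" using z2[OF that] by simp
    then show False using c1 GA(2)[OF that] by (simp add: c_def)
  qed
  have ck: "c A \<le> k" if "A \<in> G" for A
    using sub[OF GA(1)[OF that]] by (metis card_mono c_def inf_le1)
  have AU: "card (A \<inter> {z A<..}) = k - c A" if "A \<in> G" for A
    using card_split_at[OF sub(1)[OF GA(1)[OF that]], of "z A"] sub(2)[OF GA(1)[OF that]]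
    by (simp add: c_def)
  have zn: "z A < n" if "A \<in> G" for A using z2[OF that] ck[OF that] nk by linarith
  \<comment> \<open>A partner has \<open>c A - 2\<close> forced elements up to the cut and
    \<open>k + 1 - c A\<close> free ones, chosen among the \<open>n - k + 1 - c A\<close> points
    beyond the cut that lie outside \<open>A\<close>.\<close>
  have many: "((n - k + 1 - c A) choose (k + 1 - c A)) \<le> card {D \<in> M. R A D}" if A: "A \<in> G" for A
  proof -
    let ?U = "{U. U \<subseteq> {z A<..n} - A \<and> card U = k + 1 - c A}"
    let ?f = "\<lambda>U. ({2..z A} - A) \<union> U"
    have "A \<inter> {z A<..} = A \<inter> {z A<..n}" using sub(1)[OF GA(1)[OF A]] by auto
    then have "card ({z A<..n} - A) = n - z A - (k - c A)"
      using AU[OF A] by (subst card_Diff_subset_Int) (auto simp: Int_commute)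
    then have cU: "card ({z A<..n} - A) = n - k + 1 - c A"
      using z2[OF A] ck[OF A] c2[OF A] nk by linarith
    have "{1..z A} = insert 1 {2..z A}" using z2[OF A] c2[OF A] by auto
    then have "A \<inter> {1..z A} = A \<inter> {2..z A}" using GA(2)[OF A] by auto
    then have cz: "card ({2..z A} - A) = z A - 1 - c A"
      by (subst card_Diff_subset_Int) (auto simp: c_def Int_commute)
    have inj: "inj_on ?f ?U"
      by (rule inj_on_inverseI[where g = "\<lambda>E. E \<inter> {z A<..}"]) auto
    have "?f ` ?U \<subseteq> {D \<in> M. R A D}"
    proof (rule image_subsetI)
      fix U assume "U \<in> ?U"
      then have U: "U \<subseteq> {z A<..n} - A" "card U = k + 1 - c A" by auto
      have fU: "finite U" using U(1) finite_subset by blast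
      have "card (?f U) = (z A - 1 - c A) + (k + 1 - c A)"
        using U fU cz by (subst card_Un_disjoint) auto
      then have "card (?f U) = k - 1" using z2[OF A] ck[OF A] c2[OF A] by linarith
      moreover have "?f U \<subseteq> {2..n}" using U zn[OF A] z2[OF A] c2[OF A] by auto
      moreover have dis: "?f U \<inter> A = {}" using U by auto
      moreover have "insert 1 (?f U) \<notin> F"
      proof
        assume "insert 1 (?f U) \<in> F"
        then have "insert 1 (?f U) \<inter> A \<noteq> {}" using F(2) GA(1)[OF A] unfolding intersecting_def by blast
        then show False using dis GA(2)[OF A] by auto
      qed
      moreover have "?f U \<inter> {1..z A} = {2..z A} - A" using U by auto
      ultimately show "?f U \<in> {D \<in> M. R A D}"
        using fU by (auto simp: M_def nsets_def R_def)
    qed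
    then have "card (?f ` ?U) \<le> card {D \<in> M. R A D}" using finM by (intro card_mono) auto
    then show ?thesis using card_image[OF inj] n_subsets[of "{z A<..n} - A" "k + 1 - c A"] cU by simp
  qed
  \<comment> \<open>With \<open>c\<close> the common value of \<open>c A\<close>, at most
    \<open>(n - k - c) choose (k - c)\<close> members are related to \<open>D\<close>. Times the
    weight this is \<open>(k + 1 - c) / (n - k + 1 - c)\<close>, which is largest for the least
    possible value \<open>c = 2\<close>.\<close>
  have few: "(\<Sum>A | A \<in> G \<and> R A D. w A) \<le> real (k - 1) / real (n - k - 1)" if D: "D \<in> M" for D
  proof (cases "{A. A \<in> G \<and> R A D} = {}")
    case True
    then show ?thesis by (simp only: sum.empty) simp
  next
    case False
    then obtain A0 where A0: "A0 \<in> G" "R A0 D" by auto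
    have pre: "A \<inter> {1..y} = {2..y} - D" if "A \<in> G" "R A D" "y \<le> z A" for A y
    proof -
      have "{1..z A} = insert 1 {2..z A}" using z2[OF that(1)] c2[OF that(1)] by auto
      moreover have "D \<inter> A = {}" "D \<inter> {1..z A} = {2..z A} - A" using that(2) by (auto simp: R_def)
      moreover have "1 \<notin> A" using GA(2)[OF that(1)] .
      ultimately have "A \<inter> {1..z A} = {2..z A} - D" by fastforce
      then have "A \<inter> {1..z A} \<inter> {1..y} = ({2..z A} - D) \<inter> {1..y}" by simp
      moreover have "A \<inter> {1..z A} \<inter> {1..y} = A \<inter> {1..y}" "({2..z A} - D) \<inter> {1..y} = {2..y} - D"
        using that(3) by auto
      ultimately show ?thesis by simp
    qed
    \<comment> \<open>Up to the smaller of two cuts both members consist of the same points outside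
      \<open>D\<close>, so the majority of the one would already be a majority of the other.\<close>
    have zz: "z A = z A0" if "A \<in> G" "R A D" for A
    proof -
      have "z A' \<le> z A''" if "A' \<in> G" "R A' D" "A'' \<in> G" "R A'' D" for A' A''
      proof (rule ccontr)
        assume "\<not> z A' \<le> z A''"
        then have "A' \<inter> {1..z A''} = A'' \<inter> {1..z A''}" using pre[OF that(1,2)] pre[OF that(3,4)] by simp
        then have "z A'' < 2 * card (A' \<inter> {1..z A''})" using z1[OF that(3)] by (simp add: c_def)
        then show False using zle \<open>\<not> z A' \<le> z A''\<close> by blast
      qed
      then show ?thesis using that A0 by (meson antisym)
    qed
    have cc: "c A = c A0" if "A \<in> G" "R A D" for A
      using z2[OF that(1)] z2[OF A0(1)] zz[OF that] by linarith
    let ?z = "z A0" and ?c = "c A0"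
    let ?T = "{T. T \<subseteq> {?z<..n} - D \<and> card T = k - ?c}"
    have D': "D \<subseteq> {2..n}" "card D = k - 1" "finite D" using D by (auto simp: M_def nsets_def)
    have "{1..?z} = insert 1 {2..?z}" using z2[OF A0(1)] c2[OF A0(1)] by auto
    moreover have "D \<inter> {1..?z} = {2..?z} - A0" using A0(2) by (simp add: R_def)
    moreover have "card ({2..?z} - A0) = ?z - 1 - ?c"
    proof -
      have "A0 \<inter> {1..?z} = A0 \<inter> {2..?z}" using GA(2)[OF A0(1)] calculation(1) by auto
      then show ?thesis by (subst card_Diff_subset_Int) (auto simp: c_def Int_commute)
    qed
    ultimately have "card (D \<inter> {1..?z}) = ?c - 2" using z2[OF A0(1)] c2[OF A0(1)] by simp
    then have "card (D \<inter> {?z<..}) = k + 1 - ?c"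
      using card_split_at[of D n ?z] D' ck[OF A0(1)] c2[OF A0(1)] by fastforce
    moreover have "D \<inter> {?z<..} = D \<inter> {?z<..n}" using D' by auto
    ultimately have "card ({?z<..n} - D) = n - ?z - (k + 1 - ?c)"
      by (subst card_Diff_subset_Int) (auto simp: Int_commute)
    then have cT: "card ({?z<..n} - D) = n - k - ?c"
      using z2[OF A0(1)] ck[OF A0(1)] c2[OF A0(1)] nk by linarith
    have "card {A. A \<in> G \<and> R A D} \<le> card ?T"
    proof (rule card_inj_on_le[of "\<lambda>A. A \<inter> {?z<..}"])
      show "inj_on (\<lambda>A. A \<inter> {?z<..}) {A. A \<in> G \<and> R A D}"
      proof (rule inj_onI)
        fix A B assume A: "A \<in> {A. A \<in> G \<and> R A D}" and B: "B \<in> {A. A \<in> G \<and> R A D}"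
          and eq: "A \<inter> {?z<..} = B \<inter> {?z<..}"
        then have "A \<inter> {1..?z} = B \<inter> {1..?z}" using pre[of A ?z] pre[of B ?z] zz by simp
        moreover have "A = (A \<inter> {1..?z}) \<union> (A \<inter> {?z<..})" "B = (B \<inter> {1..?z}) \<union> (B \<inter> {?z<..})"
          using sub(1)[OF GA(1)[of A]] sub(1)[OF GA(1)[of B]] A B by auto
        ultimately show "A = B" using eq by metis
      qed
      show "(\<lambda>A. A \<inter> {?z<..}) ` {A. A \<in> G \<and> R A D} \<subseteq> ?T"
      proof (rule image_subsetI)
        fix A assume "A \<in> {A. A \<in> G \<and> R A D}"
        then have A: "A \<in> G" "R A D" by auto
        then show "A \<inter> {?z<..} \<in> ?T"
          using AU[OF A(1)] zz[OF A] cc[OF A] sub(1)[OF GA(1)[OF A(1)]] by (auto simp: R_def)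
      qed
      show "finite ?T" by simp
    qed
    then have le: "card {A. A \<in> G \<and> R A D} \<le> (n - k - ?c) choose (k - ?c)"
      using n_subsets[of "{?z<..n} - D" "k - ?c"] cT by simp
    have "(\<Sum>A | A \<in> G \<and> R A D. w A) = (\<Sum>A | A \<in> G \<and> R A D. w A0)"
      using cc by (intro sum.cong) (auto simp: w_def)
    also have "\<dots> = real (card {A. A \<in> G \<and> R A D}) * w A0" by simp
    also have "\<dots> \<le> real ((n - k - ?c) choose (k - ?c)) * w A0"
      using le by (intro mult_right_mono) (auto simp: w_def)
    also have "\<dots> = real (k + 1 - ?c) / real (n - k + 1 - ?c)"
    proof -
      have s: "n - k + 1 - ?c = Suc (n - k - ?c)" "k + 1 - ?c = Suc (k - ?c)"
        using ck[OF A0(1)] nk by linarith+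
      have "Suc (k - ?c) * (Suc (n - k - ?c) choose Suc (k - ?c)) = Suc (n - k - ?c) * ((n - k - ?c) choose (k - ?c))"
        using Suc_times_binomial_eq[of "n - k - ?c" "k - ?c"] by (simp only: mult.commute)
      then have "real (Suc (k - ?c)) * real (Suc (n - k - ?c) choose Suc (k - ?c)) =
          real (Suc (n - k - ?c)) * real ((n - k - ?c) choose (k - ?c))"
        by (metis of_nat_mult)
      moreover have "0 < real (Suc (n - k - ?c) choose Suc (k - ?c))"
        using ck[OF A0(1)] nk by (simp add: zero_less_binomial_iff del: binomial_Suc_Suc)
      ultimately show ?thesis unfolding w_def s by (simp add: field_simps del: binomial_Suc_Suc of_nat_Suc)
    qed
    also have "\<dots> \<le> real (k - 1) / real (n - k - 1)"
    proof -
      obtain e where e: "?c = 2 + e" using c2[OF A0(1)] nat_le_iff_add by blast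
      have eqs: "real (k + 1 - ?c) = real (k - 1) - real e" "real (n - k + 1 - ?c) = real (n - k - 1) - real e"
        and le: "real e < real (k - 1)" "real (k - 1) \<le> real (n - k - 1)"
        using e ck[OF A0(1)] nk by (auto simp: of_nat_diff)
      have "(x - d) / (y - d) \<le> x / y" if "0 \<le> d" "d < x" "x \<le> y" for x y d :: real
        using that by (simp add: field_simps mult_left_mono)
      from this[OF _ le] show ?thesis by (simp only: eqs of_nat_0_le_iff)
    qed
    finally show ?thesis .
  qed
  have wpos: "0 < w A" if "A \<in> G" for A
    using ck[OF that] c2[OF that] nk by (simp add: w_def zero_less_binomial_iff)
  have "real (card G) = (\<Sum>A\<in>G. 1)" by simp
  also have "\<dots> \<le> (\<Sum>A\<in>G. \<Sum>D | D \<in> M \<and> R A D. w A)"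
  proof (rule sum_mono)
    fix A assume A: "A \<in> G"
    have "1 = real ((n - k + 1 - c A) choose (k + 1 - c A)) * w A"
      using wpos[OF A] by (auto simp: w_def)
    also have "\<dots> \<le> real (card {D \<in> M. R A D}) * w A"
      using many[OF A] wpos[OF A] by (intro mult_right_mono) auto
    finally show "1 \<le> (\<Sum>D | D \<in> M \<and> R A D. w A)" by simp
  qed
  also have "\<dots> = (\<Sum>D\<in>M. \<Sum>A | A \<in> G \<and> R A D. w A)"
    by (rule sum.swap_restrict[OF finG finM])
  also have "\<dots> \<le> (\<Sum>D\<in>M. real (k - 1) / real (n - k - 1))"
    by (rule sum_mono) (rule few)
  finally have "real (card G) \<le> real (card M) * (real (k - 1) / real (n - k - 1))" by simp
  then have main: "real (n - k - 1) * real (card G) \<le> real (k - 1) * real (card M)"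
    using nk by (simp add: field_simps)
  have "card M + card {A \<in> F. 1 \<in> A} \<le> (n - 1) choose (k - 1)"
  proof -
    let ?H = "(\<lambda>A. A - {1}) ` {A \<in> F. 1 \<in> A}"
    have inj: "inj_on (\<lambda>A. A - {1}) {A \<in> F. 1 \<in> A}"
      by (rule inj_onI) (metis (lifting) insert_Diff mem_Collect_eq)
    have "?H \<subseteq> nsets {2..n} (k - 1)" using sub by (fastforce simp: nsets_def)
    moreover have "M \<inter> ?H = {}" by (auto simp: M_def insert_absorb)
    moreover have "M \<subseteq> nsets {2..n} (k - 1)" by (auto simp: M_def)
    moreover have "card (nsets {2..n} (k - 1)) = (n - 1) choose (k - 1)" by (simp add: card_nsets)
    ultimately have "card M + card ?H \<le> (n - 1) choose (k - 1)"
      using finM finF card_mono[of "nsets {2..n} (k - 1)" "M \<union> ?H"]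
      by (simp add: card_Un_disjoint finite_imp_finite_nsets)
    then show ?thesis using card_image[OF inj] by simp
  qed
  then have "real (card M) + real (card {A \<in> F. 1 \<in> A}) \<le> real ((n - 1) choose (k - 1))" by linarith
  from mult_left_mono[OF this, of "real (k - 1)"] show ?thesis
    using main unfolding G_def by (simp add: distrib_left)
qed

section \<open>Families of large diversity\<close>

definition hits :: "'a set set \<Rightarrow> 'a \<Rightarrow> nat" where
  "hits F x = card {A \<in> F. x \<in> A}"

text \<open>The diversity at the point \<open>x\<close>; the usual diversity of a family is its
  minimum over all points.\<close>

definition misses :: "'a set set \<Rightarrow> 'a \<Rightarrow> nat" where
  "misses F x = card {A \<in> F. x \<notin> A}"

lemma card_eq_hits_misses: "finite F \<Longrightarrow> card F = hits F x + misses F x"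
  unfolding hits_def misses_def
  by (subst card_Un_disjoint[symmetric]) (auto intro: arg_cong[where f = card])

lemma binomial_Suc_ratio:
  "real (Suc r) * real (N choose Suc r) = (real N - real r) * real (N choose r)"
proof (cases "r \<le> N")
  case True
  have "Suc r * (N choose Suc r) = (N - r) * (N choose r)"
    using binomial_absorption[of r N] binomial_absorb_comp[of N r] by simp
  then have "real (Suc r) * real (N choose Suc r) = real (N - r) * real (N choose r)"
    by (metis of_nat_mult)
  then show ?thesis using True by (simp add: of_nat_diff)
qed (simp add: binomial_eq_0)

lemma binomial_pred_ratio:
  "r \<le> N \<Longrightarrow> (real N - real r) * real (N choose r) = real N * real ((N - 1) choose r)"
  using binomial_absorb_comp[of N r] by (metis of_nat_diff of_nat_mult)

lemma finite_subset_nsets: "finite X \<Longrightarrow> F \<subseteq> nsets X k \<Longrightarrow> finite F"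
  using finite_subset finite_imp_finite_nsets by blast

text \<open>A member through \<open>x\<close> meets a member avoiding \<open>x\<close> in some other
  point. So the members avoiding \<open>x\<close> and the link of \<open>x\<close> are
  cross-intersecting on the remaining \<open>n - 1\<close> points.\<close>

lemma star_bounds:
  assumes F: "F \<subseteq> nsets X k" "finite X" "card X = n" "intersecting F"
    and x: "x \<in> X" and k: "2 * k \<le> n" "1 \<le> k" and m: "n - 1 - k \<le> m"
  shows "misses F x \<le> m choose (n - 1 - k) \<Longrightarrow>
      misses F x * (m choose (k - 1)) + hits F x * (m choose (n - 1 - k))
      \<le> ((n - 1) choose (k - 1)) * (m choose (n - 1 - k))"
    and "m choose (n - 1 - k) \<le> misses F x \<Longrightarrow>
      (m choose (k - 1)) + hits F x \<le> (n - 1) choose (k - 1)"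
proof -
  let ?G = "{A \<in> F. x \<notin> A}" and ?H = "(\<lambda>A. A - {x}) ` {A \<in> F. x \<in> A}"
  have inj: "inj_on (\<lambda>A. A - {x}) {A \<in> F. x \<in> A}"
    by (rule inj_onI) (metis (lifting) insert_Diff mem_Collect_eq)
  have h: "hits F x = card ?H" unfolding hits_def by (simp add: card_image[OF inj])
  have sub: "A \<subseteq> X" "card A = k" "finite A" if "A \<in> F" for A
    using that F(1) by (auto simp: nsets_def)
  have cross: "A \<inter> B \<noteq> {}" if "A \<in> ?G" "B \<in> ?H" for A B
  proof -
    obtain C where C: "C \<in> F" "B = C - {x}" using \<open>B \<in> ?H\<close> by auto
    then have "A \<inter> C \<noteq> {}" using F(4) that(1) unfolding intersecting_def by blast
    then show ?thesis using C that(1) by auto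
  qed
  have H: "B \<subseteq> X - {x} \<and> card B = k - 1" if "B \<in> ?H" for B using that sub by auto
  have G: "A \<subseteq> X - {x} \<and> card A = k" if "A \<in> ?G" for A using that sub by auto
  have X: "finite (X - {x})" "card (X - {x}) = n - 1" using F x by auto
  have kk: "k + (k - 1) \<le> n - 1" using k by linarith
  note bounds = cross_intersecting_bounds[OF X G H cross kk m]
  show "misses F x \<le> m choose (n - 1 - k) \<Longrightarrow>
      misses F x * (m choose (k - 1)) + hits F x * (m choose (n - 1 - k))
      \<le> ((n - 1) choose (k - 1)) * (m choose (n - 1 - k))"
    unfolding h misses_def by (rule bounds(1))
  show "m choose (n - 1 - k) \<le> misses F x \<Longrightarrow>
      (m choose (k - 1)) + hits F x \<le> (n - 1) choose (k - 1)"
    unfolding h misses_def by (rule bounds(2))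
qed

text \<open>Replaces the two binomials of a Kruskal--Katona comparison by the small factors
  \<open>u\<close> and \<open>v\<close>, whose ratio they share.\<close>

lemma divide_out_ratio:
  fixes g h c x y :: nat and u v :: real
  assumes "g * x + h * y \<le> c * y" "0 < y" "v * real x = u * real y" "0 < v"
  shows "u * real g + v * real h \<le> v * real c"
proof -
  have "real g * real x + real h * real y \<le> real c * real y"
    using assms(1) by (metis of_nat_add of_nat_le_iff of_nat_mult)
  then have "v * (real g * real x + real h * real y) \<le> v * (real c * real y)"
    using assms(4) by simp
  moreover have "v * (real g * real x + real h * real y) = (u * real g + v * real h) * real y"
  proof -
    have "v * (real g * real x + real h * real y) = real g * (v * real x) + v * real h * real y"
      by (simp add: algebra_simps)
    then show ?thesis by (simp only: assms(3)) (simp add: algebra_simps)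
  qed
  ultimately have "(u * real g + v * real h) * real y \<le> (v * real c) * real y"
    by (simp only: mult.assoc)
  then show ?thesis using assms(2) by (simp add: mult_le_cancel_right)
qed

text \<open>The calibration is \<open>m = n - 3\<close>. It is modelled on the \<open>k\<close>-sets
  meeting a fixed triple through \<open>x\<close> in at least two points:
  \<open>(n - 3) choose (k - 2)\<close> of them avoid \<open>x\<close>, and
  \<open>(n - 3) choose (k - 1)\<close> sets are missing from the link.\<close>

lemma star_ratio_two:
  assumes F: "F \<subseteq> nsets X k" "finite X" "card X = n" "intersecting F"
    and x: "x \<in> X" and k: "2 * k < n" "2 \<le> k" and le: "misses F x \<le> (n - 3) choose (k - 2)"
  shows "real (n - k - 1) * misses F x + real (k - 1) * hits F x \<le> real (k - 1) * ((n - 1) choose (k - 1))"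
proof -
  have sym: "(n - 3) choose (n - 1 - k) = (n - 3) choose (k - 2)"
    using k by (subst binomial_symmetric) (auto intro: arg_cong2[where f = "(choose)"])
  have *: "misses F x * ((n - 3) choose (k - 1)) + hits F x * ((n - 3) choose (k - 2))
      \<le> ((n - 1) choose (k - 1)) * ((n - 3) choose (k - 2))"
    using star_bounds(1)[OF F x, of "n - 3"] k le unfolding sym by simp
  have ratio: "real (k - 1) * real ((n - 3) choose (k - 1)) = real (n - k - 1) * real ((n - 3) choose (k - 2))"
  proof -
    have "k - 1 = Suc (k - 2)" "real (n - 3) - real (k - 2) = real (n - k - 1)"
      using k by (auto simp: of_nat_diff)
    then show ?thesis using binomial_Suc_ratio[of "k - 2" "n - 3"] by metis
  qed
  have "0 < (n - 3) choose (k - 2)" using k by (intro zero_less_binomial) linarith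
  from divide_out_ratio[OF * this ratio] show ?thesis using k by simp
qed

text \<open>The calibration is \<open>m = n - 4\<close>. In the model family the members avoiding
  \<open>x\<close> contain a fixed triple and those through \<open>x\<close> meet it. The lower
  threshold buys a second factor in the ratio.\<close>

lemma star_ratio_three:
  assumes F: "F \<subseteq> nsets X k" "finite X" "card X = n" "intersecting F"
    and x: "x \<in> X" and k: "2 * k < n" "3 \<le> k" and le: "misses F x \<le> (n - 4) choose (k - 3)"
  shows "real (n - k - 1) * real (n - k - 2) * misses F x + real (k - 1) * real (k - 2) * hits F x
    \<le> real (k - 1) * real (k - 2) * ((n - 1) choose (k - 1))"
proof -
  have sym: "(n - 4) choose (n - 1 - k) = (n - 4) choose (k - 3)"
    using k by (subst binomial_symmetric) (auto intro: arg_cong2[where f = "(choose)"])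
  have *: "misses F x * ((n - 4) choose (k - 1)) + hits F x * ((n - 4) choose (k - 3))
      \<le> ((n - 1) choose (k - 1)) * ((n - 4) choose (k - 3))"
    using star_bounds(1)[OF F x, of "n - 4"] k le unfolding sym by simp
  have ratio: "real (k - 1) * real (k - 2) * real ((n - 4) choose (k - 1))
      = real (n - k - 1) * real (n - k - 2) * real ((n - 4) choose (k - 3))"
  proof -
    have "k - 1 = Suc (k - 2)" "k - 2 = Suc (k - 3)" "real (n - 4) - real (k - 2) = real (n - k - 2)"
      "real (n - 4) - real (k - 3) = real (n - k - 1)"
      using k by (auto simp: of_nat_diff)
    then have "real (k - 1) * real ((n - 4) choose (k - 1)) = real (n - k - 2) * real ((n - 4) choose (k - 2))"
      "real (k - 2) * real ((n - 4) choose (k - 2)) = real (n - k - 1) * real ((n - 4) choose (k - 3))"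
      using binomial_Suc_ratio[of "k - 2" "n - 4"] binomial_Suc_ratio[of "k - 3" "n - 4"] by metis+
    then show ?thesis by (metis mult.assoc mult.left_commute)
  qed
  have "0 < (n - 4) choose (k - 3)" using k by (intro zero_less_binomial) linarith
  from divide_out_ratio[OF * this ratio] show ?thesis using k by simp
qed

section \<open>Diversity under shifting\<close>

text \<open>Trouble can only come from an unmoved \<open>A\<close> and a moved \<open>B\<close>. If
  they were disjoint, \<open>A\<close> could meet the original of \<open>B\<close> only in
  \<open>j\<close>; having stayed in place, \<open>A\<close> would have its exchanged copy in
  \<open>F\<close>, disjoint from that original.\<close>

lemma intersecting_shift_family:
  assumes "i \<noteq> j" "intersecting F"
  shows "intersecting (shift_family i j F)"
proof -
  have mixed: "A \<inter> B \<noteq> {}"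
    if A: "A \<in> F" "j \<in> A \<and> i \<notin> A \<longrightarrow> insert i (A - {j}) \<in> F"
      and B: "i \<in> B" "j \<notin> B" "insert j (B - {i}) \<in> F" for A B
  proof
    assume dis: "A \<inter> B = {}"
    have "A \<inter> insert j (B - {i}) \<noteq> {}" using assms(2) A(1) B(3) unfolding intersecting_def by blast
    then have "j \<in> A" "i \<notin> A" using dis B(1) by auto
    then have "insert i (A - {j}) \<inter> insert j (B - {i}) \<noteq> {}"
      using assms(2) A(2) B(3) unfolding intersecting_def by blast
    then show False using dis assms(1) by auto
  qed
  show ?thesis unfolding intersecting_def
  proof (intro ballI)
    fix A B assume A: "A \<in> shift_family i j F" and B: "B \<in> shift_family i j F"
    show "A \<inter> B \<noteq> {}"
      using A[unfolded in_shift_family_iff[OF assms(1)]] B[unfolded in_shift_family_iff[OF assms(1)]]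
    proof (elim disjE conjE)
      assume "A \<in> F" "B \<in> F"
      then show ?thesis using assms(2) unfolding intersecting_def by blast
    next
      assume "i \<in> A" "i \<in> B"
      then show ?thesis by blast
    next
      assume "A \<in> F" "j \<in> A \<and> i \<notin> A \<longrightarrow> insert i (A - {j}) \<in> F" "i \<in> B" "j \<notin> B" "insert j (B - {i}) \<in> F"
      then show ?thesis by (rule mixed)
    next
      assume "B \<in> F" "j \<in> B \<and> i \<notin> B \<longrightarrow> insert i (B - {j}) \<in> F" "i \<in> A" "j \<notin> A" "insert j (A - {i}) \<in> F"
      then have "B \<inter> A \<noteq> {}" by (rule mixed)
      then show ?thesis by blast
    qed
  qed
qed

text \<open>The only element that a shift adds to a set is \<open>i\<close>, so \<open>i\<close> is
  the one point whose diversity can drop.\<close>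

lemma misses_shift_family:
  assumes "i \<noteq> j" "finite F" "x \<noteq> i"
  shows "misses F x \<le> misses (shift_family i j F) x"
proof -
  have "shift i j F ` {A \<in> F. x \<notin> A} \<subseteq> {B \<in> shift_family i j F. x \<notin> B}"
    using assms(3) unfolding shift_family_def shift_def by auto
  then have "card (shift i j F ` {A \<in> F. x \<notin> A}) \<le> misses (shift_family i j F) x"
    unfolding misses_def using finite_shift_family[OF assms(2)] by (intro card_mono) auto
  moreover have "inj_on (shift i j F) {A \<in> F. x \<notin> A}"
    by (rule inj_on_subset[OF inj_on_shift[OF assms(1)]]) auto
  ultimately show ?thesis unfolding misses_def by (simp add: card_image)
qed

text \<open>On the other \<open>n - 2\<close> points the members with traces \<open>{}\<close> and
  \<open>{i, j}\<close> form one cross-intersecting pair, those with traces \<open>{i}\<close> and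
  \<open>{j}\<close> another. Their bounds add up by Pascal's rule. In each pair one class carries
  the larger weight \<open>n - k - 1\<close>; these two classes together are all members avoiding
  \<open>i\<close> or all members avoiding \<open>j\<close>, so the surplus \<open>n - 2 * k\<close>
  falls on at least \<open>(n - 3) choose (k - 2)\<close> sets.\<close>

lemma two_element_split_bound:
  assumes F: "F \<subseteq> nsets X k" "finite X" "card X = n" "intersecting F"
    and ij: "i \<in> X" "j \<in> X" "i \<noteq> j" and k: "2 * k < n" "4 \<le> k"
    and a: "card {A \<in> F. i \<notin> A \<and> j \<notin> A} \<le> (n - 5) choose (k - 3)"
    and i: "(n - 3) choose (k - 2) \<le> misses F i" and j: "(n - 3) choose (k - 2) \<le> misses F j"
  shows "real (k - 1) * card F + real (n - 2 * k) * ((n - 3) choose (k - 2)) \<le> real (k - 1) * ((n - 1) choose (k - 1))"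
proof -
  define S where "S I J = {A \<in> F. (i \<in> A) = I \<and> (j \<in> A) = J}" for I J
  let ?g = "(n - 3) choose (k - 2)"
  have finF: "finite F" using finite_subset_nsets F by blast
  have fS: "finite (S I J)" for I J using finF by (simp add: S_def)
  have sub: "A \<subseteq> X" "card A = k" "finite A" if "A \<in> F" for A
    using that F(1) by (auto simp: nsets_def)
  have X: "finite (X - {i, j})" "card (X - {i, j}) = n - 2" using F ij by (auto simp: card_Diff_subset)
  let ?r = "\<lambda>A. A - {i, j}"
  have inj: "card (?r ` S I J) = card (S I J)" for I J
    by (rule card_image, rule inj_on_inverseI[where
          g = "\<lambda>B. B \<union> (if I then {i} else {}) \<union> (if J then {j} else {})"])
      (auto simp: S_def)
  have rk: "B \<subseteq> X - {i, j} \<and> card B = k - (if I then 1 else 0) - (if J then 1 else 0)"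
    if B: "B \<in> ?r ` S I J" for B I J
  proof -
    obtain A where A: "A \<in> F" "(i \<in> A) = I" "(j \<in> A) = J" "B = A - {i, j}"
      using B unfolding S_def by blast
    moreover have "A - {i, j} = A - {i} - {j}" by auto
    ultimately show ?thesis using sub[OF A(1)] ij by (auto simp: card_Diff_singleton_if)
  qed
  have cross: "A \<inter> B \<noteq> {}" if AB: "A \<in> ?r ` S I J" "B \<in> ?r ` S (\<not> I) (\<not> J)" for A B I J
  proof -
    obtain A' B' where "A' \<in> S I J" "A = ?r A'" "B' \<in> S (\<not> I) (\<not> J)" "B = ?r B'" using AB by auto
    moreover from this have "A' \<inter> B' \<noteq> {}" using F(4) unfolding S_def intersecting_def by blast
    ultimately show ?thesis unfolding S_def by blast
  qed
  have split: "{A \<in> F. i \<notin> A} = S False False \<union> S False True" "{A \<in> F. j \<notin> A} = S False False \<union> S True False"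
    "{A \<in> F. i \<in> A} = S True False \<union> S True True"
    "{A \<in> F. i \<notin> A \<and> j \<notin> A} = S False False"
    by (auto simp: S_def)
  have mi: "misses F i = card (S False False) + card (S False True)"
    and mj: "misses F j = card (S False False) + card (S True False)"
    and hi: "hits F i = card (S True False) + card (S True True)"
    unfolding misses_def hits_def split by (rule card_Un_disjoint[OF fS fS], (auto simp: S_def)[1])+
  have cF: "card F = card (S True True) + card (S False False) + card (S True False) + card (S False True)"
    using card_eq_hits_misses[OF finF, of i] mi hi by simp
  have ratio: "real (k - 1) * real ((n - 3) choose (k - 1)) = real (n - k - 1) * real ?g"
  proof -
    have "k - 1 = Suc (k - 2)" "real (n - 3) - real (k - 2) = real (n - k - 1)"
      using k by (auto simp: of_nat_diff)
    then show ?thesis using binomial_Suc_ratio[of "k - 2" "n - 3"] by metis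
  qed
  \<comment> \<open>Kruskal--Katona gives the ratio \<open>(n - k - 2) / (k - 2)\<close> here. It is
    weakened to \<open>(n - k - 1) / (k - 1)\<close> so that both pairs carry the same
    weights.\<close>
  have ends: "real (n - k - 1) * card (S False False) + real (k - 1) * card (S True True)
      \<le> real (k - 1) * ((n - 2) choose (k - 2))"
  proof -
    let ?a = "real (card (S False False))" and ?b = "real (card (S True True))"
      and ?c = "real ((n - 2) choose (k - 2))"
    have sym: "(n - 5) choose (n - 2 - k) = (n - 5) choose (k - 3)"
      using k by (subst binomial_symmetric) (auto intro: arg_cong2[where f = "(choose)"])
    have cr: "card (S False False) * ((n - 5) choose (k - 2)) + card (S True True) * ((n - 5) choose (k - 3))
        \<le> ((n - 2) choose (k - 2)) * ((n - 5) choose (k - 3))"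
    proof -
      have G: "A \<subseteq> X - {i, j} \<and> card A = k" if "A \<in> ?r ` S False False" for A
        using rk[OF that] by simp
      have H: "B \<subseteq> X - {i, j} \<and> card B = k - 2" if "B \<in> ?r ` S True True" for B
        using rk[OF that] by simp
      have c: "A \<inter> B \<noteq> {}" if "A \<in> ?r ` S False False" "B \<in> ?r ` S True True" for A B
        using cross[of A False False B] that by simp
      have kk: "k + (k - 2) \<le> n - 2" "n - 2 - k \<le> n - 5" using k by linarith+
      show ?thesis
        using cross_intersecting_bounds(1)[where G = "?r ` S False False" and H = "?r ` S True True",
            OF X G H c kk] a
        unfolding inj sym split by simp
    qed
    have rat: "real (k - 2) * real ((n - 5) choose (k - 2)) = real (n - k - 2) * real ((n - 5) choose (k - 3))"
    proof -
      have "k - 2 = Suc (k - 3)" "real (n - 5) - real (k - 3) = real (n - k - 2)"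
        using k by (auto simp: of_nat_diff)
      then show ?thesis using binomial_Suc_ratio[of "k - 3" "n - 5"] by metis
    qed
    have "0 < (n - 5) choose (k - 3)" using k by (intro zero_less_binomial) linarith
    from divide_out_ratio[OF cr this rat]
    have *: "real (n - k - 2) * ?a + real (k - 2) * ?b \<le> real (k - 2) * ?c" using k by simp
    have "real (k - 2) * (real (n - k - 1) * ?a) \<le> real (k - 1) * (real (n - k - 2) * ?a)"
    proof -
      have "real (k - 2) * real (n - k - 1) \<le> real (k - 1) * real (n - k - 2)"
        using k by (simp add: of_nat_diff algebra_simps)
      then have "real (k - 2) * real (n - k - 1) * ?a \<le> real (k - 1) * real (n - k - 2) * ?a"
        by (intro mult_right_mono) auto
      then show ?thesis by (simp only: mult.assoc)
    qed
    moreover have "real (k - 1) * (real (n - k - 2) * ?a + real (k - 2) * ?b) \<le> real (k - 1) * (real (k - 2) * ?c)"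
      using * by (intro mult_left_mono) auto
    ultimately have "real (k - 2) * (real (n - k - 1) * ?a + real (k - 1) * ?b) \<le> real (k - 2) * (real (k - 1) * ?c)"
      by (simp add: algebra_simps)
    then show ?thesis using k by (simp add: mult_le_cancel_left)
  qed
  have sym: "(n - 3) choose (n - 2 - (k - 1)) = ?g"
    using k by (subst binomial_symmetric) (auto intro: arg_cong2[where f = "(choose)"])
  have G: "A \<subseteq> X - {i, j} \<and> card A = k - 1" if "A \<in> ?r ` S I (\<not> I)" for A I
    using rk[OF that] by (cases I) simp_all
  have H: "A \<subseteq> X - {i, j} \<and> card A = k - 1" if "A \<in> ?r ` S (\<not> I) I" for A I
    using rk[OF that] by (cases I) simp_all
  have c: "A \<inter> B \<noteq> {}" if "A \<in> ?r ` S I (\<not> I)" "B \<in> ?r ` S (\<not> I) I" for A B I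
    using cross[of A I "\<not> I" B] that by simp
  have kk: "k - 1 + (k - 1) \<le> n - 2" "n - 2 - (k - 1) \<le> n - 3" using k by linarith+
  have bounds: "card (S I (\<not> I)) \<le> ?g \<Longrightarrow>
      card (S I (\<not> I)) * ((n - 3) choose (k - 1)) + card (S (\<not> I) I) * ?g \<le> ((n - 2) choose (k - 1)) * ?g"
    "?g \<le> card (S I (\<not> I)) \<Longrightarrow> ((n - 3) choose (k - 1)) + card (S (\<not> I) I) \<le> (n - 2) choose (k - 1)" for I
    using cross_intersecting_bounds[where G = "?r ` S I (\<not> I)" and H = "?r ` S (\<not> I) I",
        OF X G[where I = I] H[where I = I] c[where I = I] kk]
    unfolding inj sym by simp_all
  have mid: "real (n - k - 1) * card (S I (\<not> I)) + real (k - 1) * card (S (\<not> I) I)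
      \<le> real (k - 1) * ((n - 2) choose (k - 1))" if le: "card (S I (\<not> I)) \<le> ?g" for I
  proof -
    have "0 < ?g" using k by (intro zero_less_binomial) linarith
    from divide_out_ratio[OF bounds(1)[OF le] this ratio] show ?thesis using k by simp
  qed
  \<comment> \<open>If one class exceeds the threshold, the second cross-intersecting bound and
    Pascal's rule push the other below it.\<close>
  have "card (S True False) \<le> ?g \<or> card (S False True) \<le> ?g"
  proof (rule disjCI)
    assume "\<not> card (S False True) \<le> ?g"
    then have "((n - 3) choose (k - 1)) + card (S True False) \<le> (n - 2) choose (k - 1)"
      using bounds(2)[of False] by simp
    moreover have "(n - 2) choose (k - 1) = ((n - 3) choose (k - 1)) + ?g"
    proof -
      have "n - 2 = Suc (n - 3)" "k - 1 = Suc (k - 2)" using k by linarith+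
      then show ?thesis using binomial_Suc_Suc[of "n - 3" "k - 2"] by (metis add.commute)
    qed
    ultimately show "card (S True False) \<le> ?g" by simp
  qed
  moreover have pascal: "real ((n - 1) choose (k - 1)) = real ((n - 2) choose (k - 2)) + real ((n - 2) choose (k - 1))"
  proof -
    have "n - 1 = Suc (n - 2)" "k - 1 = Suc (k - 2)" using k by linarith+
    then show ?thesis using binomial_Suc_Suc[of "n - 2" "k - 2"] by (metis of_nat_add)
  qed
  moreover have d: "real (n - 2 * k) = real (n - k - 1) - real (k - 1)" using k by (simp add: of_nat_diff)
  moreover have pos: "0 \<le> real (n - 2 * k)" by simp
  ultimately show ?thesis
  proof (elim disjE)
    assume "card (S True False) \<le> ?g"
    from mid[of True] this have m: "real (n - k - 1) * card (S True False) + real (k - 1) * card (S False True)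
      \<le> real (k - 1) * ((n - 2) choose (k - 1))" by simp
    have "real (n - 2 * k) * ?g \<le> real (n - 2 * k) * (card (S False False) + card (S True False))"
      using j mj by (intro mult_left_mono) auto
    then show ?thesis using m ends unfolding cF pascal d by (simp add: algebra_simps)
  next
    assume "card (S False True) \<le> ?g"
    from mid[of False] this have m: "real (n - k - 1) * card (S False True) + real (k - 1) * card (S True False)
      \<le> real (k - 1) * ((n - 2) choose (k - 1))" by simp
    have "real (n - 2 * k) * ?g \<le> real (n - 2 * k) * (card (S False False) + card (S False True))"
      using i mi by (intro mult_left_mono) auto
    then show ?thesis using m ends unfolding cF pascal d by (simp add: algebra_simps)
  qed
qed

text \<open>With \<open>M\<close> the number of sets missing from a link and \<open>g\<close> the
  diversity, \<open>M - g\<close> is at least the share \<open>1 - v / u\<close> of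
  \<open>M\<close>, hence of any lower bound \<open>X\<close> for \<open>M\<close>.\<close>

lemma gain_of_ratio:
  fixes g M X u v :: real
  assumes "u * g \<le> v * M" "X \<le> M" "0 < v" "v \<le> u"
  shows "g + (1 - v / u) * X \<le> M"
proof -
  have u: "0 < u" using assms by linarith
  have "g \<le> v / u * M" using assms(1) u by (simp add: field_simps)
  moreover have "(1 - v / u) * X \<le> (1 - v / u) * M"
    using assms u by (intro mult_left_mono) auto
  ultimately show ?thesis by (simp add: algebra_simps)
qed

text \<open>The termination measure for shifting with varying \<open>i < j\<close>: each moved
  member loses \<open>j - i\<close>, and \<open>A\<close> does move.\<close>

lemma sum_elements_shift_family:
  fixes F :: "nat set set"
  assumes F: "finite F" "\<And>A. A \<in> F \<Longrightarrow> finite A" and ij: "i < j"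
    and A: "A \<in> F" "j \<in> A" "i \<notin> A" "insert i (A - {j}) \<notin> F"
  shows "(\<Sum>B\<in>shift_family i j F. \<Sum>B) < (\<Sum>B\<in>F. \<Sum>B)"
proof -
  have moved: "\<Sum>(insert i (B - {j})) < \<Sum>B" if "B \<in> F" "j \<in> B" "i \<notin> B" for B
  proof -
    have "\<Sum>B = j + \<Sum>(B - {j})" using that F(2) by (intro sum.remove) auto
    moreover have "\<Sum>(insert i (B - {j})) = i + \<Sum>(B - {j})" using that F(2) by simp
    ultimately show ?thesis using ij by simp
  qed
  have "(\<Sum>B\<in>shift_family i j F. \<Sum>B) = (\<Sum>B\<in>F. \<Sum>(shift i j F B))"
    unfolding shift_family_def using inj_on_shift[of i j F] ij by (simp add: sum.reindex)
  also have "\<dots> < (\<Sum>B\<in>F. \<Sum>B)"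
  proof (rule sum_strict_mono_ex1)
    show "\<forall>B\<in>F. \<Sum>(shift i j F B) \<le> \<Sum>B" using moved unfolding shift_def by (auto intro: less_imp_le)
    have "\<Sum>(shift i j F A) < \<Sum>A" using moved[OF A(1-3)] A unfolding shift_def by simp
    then show "\<exists>B\<in>F. \<Sum>(shift i j F B) < \<Sum>B" using A(1) by blast
  qed (rule F(1))
  finally show ?thesis .
qed

text \<open>Shifting continues as long as all diversities stay above the threshold. The subtracted
  gain is what remains in the least favourable outcome: after a shift the diversity of
  \<open>i\<close> lies between \<open>(n - 5) choose (k - 4)\<close> and
  \<open>(n - 4) choose (k - 3)\<close>. Then at least \<open>(n - 5) choose (k - 1)\<close> sets
  are missing from the link of \<open>i\<close>, and the ratio with two factors applies.\<close>

lemma large_diversity_bound: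
  assumes F: "F \<subseteq> nsets {1..n} k" "intersecting F" and k: "2 * k < n" "4 \<le> k"
    and div: "\<And>x. x \<in> {1..n} \<Longrightarrow> (n - 3) choose (k - 2) \<le> misses F x"
  shows "real (card F) + (1 - real (k - 1) * real (k - 2) / (real (n - k - 1) * real (n - k - 2)))
      * real ((n - 5) choose (k - 1)) \<le> real ((n - 1) choose (k - 1))"
proof -
  let ?g = "(n - 3) choose (k - 2)" and ?C = "real ((n - 1) choose (k - 1))"
  define u v u' v' where "u = real (n - k - 1)" and "v = real (k - 1)"
    and "u' = real (n - k - 2)" and "v' = real (k - 2)"
  define W where "W = (1 - v * v' / (u * u')) * real ((n - 5) choose (k - 1))"
  have uv: "0 < v" "v < u" "0 < v'" "v' < u'" "u' = u - 1" "v' = v - 1" "real (n - 2 * k) = u - v"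
    "real (n - 4) = u + v - 2"
    using k by (auto simp: u_def v_def u'_def v'_def of_nat_diff)
  \<comment> \<open>The other outcomes gain \<open>1 - v / u\<close> times a binomial with top
    \<open>n - 4\<close> or \<open>n - 3\<close>; this comparison lets all of them end in the same
    \<open>W\<close>.\<close>
  have W4: "W \<le> (1 - v / u) * real ((n - 4) choose (k - 1))"
  proof -
    let ?c = "real ((n - 4) choose (k - 1))"
    have "(real (n - 4) - real (k - 1)) * ?c = real (n - 4) * real ((n - 4 - 1) choose (k - 1))"
      using k by (intro binomial_pred_ratio) linarith
    moreover have "n - 4 - 1 = n - 5" by simp
    ultimately have "(u - 2) * ?c = (u + v - 2) * real ((n - 5) choose (k - 1))"
      using uv(8) by (simp add: v_def)
    moreover have pos: "0 < u + v - 2" using uv k by (simp add: u_def v_def of_nat_diff)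
    ultimately have c5: "real ((n - 5) choose (k - 1)) = (u - 2) / (u + v - 2) * ?c"
      by (simp add: field_simps)
    have "1 - v * v' / (u * u') = (1 - v / u) * ((u + v - 1) / (u - 1))"
    proof -
      have "0 < u" "0 < u - 1" using uv by linarith+
      then show ?thesis unfolding uv(5,6) by (simp add: divide_simps) (simp add: algebra_simps)
    qed
    then have "W = (1 - v / u) * (((u + v - 1) / (u - 1)) * ((u - 2) / (u + v - 2))) * ?c"
      unfolding W_def c5 by simp
    moreover have "((u + v - 1) / (u - 1)) * ((u - 2) / (u + v - 2)) \<le> 1"
    proof -
      have "(u + v - 1) * (u - 2) \<le> (u - 1) * (u + v - 2)" using uv by (simp add: algebra_simps)
      moreover have "0 < (u - 1) * (u + v - 2)" using uv pos by simp
      ultimately show ?thesis by simp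
    qed
    then have "(1 - v / u) * (((u + v - 1) / (u - 1)) * ((u - 2) / (u + v - 2))) \<le> (1 - v / u) * 1"
      using uv by (intro mult_left_mono) auto
    ultimately show ?thesis by (metis mult.right_neutral mult_right_mono of_nat_0_le_iff)
  qed
  \<comment> \<open>Shared by the shifted family and the split over \<open>{i, j}\<close>:
    \<open>(u - v) / v\<close> times \<open>?g\<close> equals \<open>1 - v / u\<close> times
    \<open>(n - 3) choose (k - 1)\<close>.\<close>
  have finish: "real (card G) + W \<le> ?C"
    if "v * real (card G) + (u - v) * real ?g \<le> v * ?C" for G :: "nat set set"
  proof -
    have "k - 1 = Suc (k - 2)" "real (n - 3) - real (k - 2) = u"
      using k by (auto simp: of_nat_diff u_def)
    then have c3: "v * real ((n - 3) choose (k - 1)) = u * real ?g"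
      unfolding v_def using binomial_Suc_ratio[of "k - 2" "n - 3"] by metis
    have "v * ((1 - v / u) * real ((n - 3) choose (k - 1))) = (1 - v / u) * (u * real ?g)"
      using c3 by (metis mult.left_commute)
    also have "\<dots> = (u - v) * real ?g" using uv by (simp add: field_simps)
    finally have e: "v * ((1 - v / u) * real ((n - 3) choose (k - 1))) = (u - v) * real ?g" .
    have "(n - 4) choose (k - 1) \<le> (n - 3) choose (k - 1)" by (intro binomial_right_mono) simp
    then have "(1 - v / u) * real ((n - 4) choose (k - 1)) \<le> (1 - v / u) * real ((n - 3) choose (k - 1))"
      using uv by (intro mult_left_mono) auto
    then have "W \<le> (1 - v / u) * real ((n - 3) choose (k - 1))" using W4 by linarith
    then have "v * W \<le> (u - v) * real ?g" using uv(1) unfolding e[symmetric] by (intro mult_left_mono) auto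
    then have "v * (real (card G) + W) \<le> v * ?C" using that by (simp add: distrib_left)
    then show ?thesis using uv(1) by simp
  qed
  have "real (card F) + W \<le> ?C"
    using F div
  proof (induction "\<Sum>B\<in>F. \<Sum>B" arbitrary: F rule: less_induct)
    case less
    note F = less.prems
    have finF: "finite F" using finite_subset_nsets F by blast
    have unif: "finite A \<and> card A = k" "A \<subseteq> {1..n}" if "A \<in> F" for A
      using that F(1) by (auto simp: nsets_def)
    show ?case
    proof (cases "shifted F")
      case True
      have "u * misses F 1 + v * hits F 1 \<le> v * ?C"
        using shifted_diversity_bound[OF F(1,2) True] k by (simp add: u_def v_def misses_def hits_def)
      moreover have "(u - v) * real ?g \<le> (u - v) * misses F 1"
        using F(3)[of 1] k uv by (intro mult_left_mono) auto
      ultimately have "v * real (card F) + (u - v) * real ?g \<le> v * ?C"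
        using card_eq_hits_misses[OF finF, of 1] by (simp add: algebra_simps)
      then show ?thesis by (rule finish)
    next
      case False
      then obtain A i j where A: "A \<in> F" "1 \<le> i" "i < j" "j \<in> A" "i \<notin> A" "insert i (A - {j}) \<notin> F"
        unfolding shifted_def by blast
      have ij: "i \<noteq> j" "i \<in> {1..n}" "j \<in> {1..n}" using A unif(2)[OF A(1)] by auto
      let ?F = "shift_family i j F"
      have "B \<subseteq> {1..n}" if "B \<in> ?F" for B
      proof -
        obtain B' where "B' \<in> F" "B = shift i j F B'"
          using \<open>B \<in> ?F\<close> unfolding shift_family_def by blast
        then show ?thesis using unif(2)[of B'] ij(2) unfolding shift_def by auto
      qed
      then have F': "?F \<subseteq> nsets {1..n} k" "intersecting ?F"
        using shift_family_uniform[OF ij(1) unif(1)] intersecting_shift_family[OF ij(1) F(2)]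
        by (auto simp: nsets_def)
      have cF: "card F = hits ?F i + misses ?F i"
        using card_eq_hits_misses[OF finite_shift_family[OF finF]] card_shift_family[OF ij(1), of F] by metis
      have sum: "(\<Sum>B\<in>?F. \<Sum>B) < (\<Sum>B\<in>F. \<Sum>B)"
        using unif by (intro sum_elements_shift_family[OF finF _ A(3,1,4-6)]) auto
      have X: "finite {1..n}" "card {1..n} = n" by auto
      note star = star_bounds(2)[OF F'(1) X F'(2) ij(2)]
      \<comment> \<open>The new diversity of \<open>i\<close> decides. In the top range the
        induction goes on, in the two middle ranges the star at \<open>i\<close> in the shifted
        family settles the bound, and in the bottom range the argument returns to \<open>F\<close>
        itself.\<close>
      consider "?g \<le> misses ?F i"
        | "misses ?F i \<le> ?g" "(n - 4) choose (k - 3) \<le> misses ?F i"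
        | "misses ?F i \<le> (n - 4) choose (k - 3)" "(n - 5) choose (k - 4) \<le> misses ?F i"
        | "misses ?F i \<le> (n - 5) choose (k - 4)"
        by linarith
      then show ?thesis
      proof cases
        case 1
        have "?g \<le> misses ?F x" if "x \<in> {1..n}" for x
          using 1 F(3)[OF that] misses_shift_family[OF ij(1) finF, of x] by (cases "x = i") auto
        then have "real (card ?F) + W \<le> ?C" using less.hyps[OF sum F'] by blast
        then show ?thesis by (simp add: card_shift_family[OF ij(1)])
      next
        case 2
        have sym: "(n - 4) choose (n - 1 - k) = (n - 4) choose (k - 3)"
          using k by (subst binomial_symmetric) (auto intro: arg_cong2[where f = "(choose)"])
        have "((n - 4) choose (k - 1)) + hits ?F i \<le> (n - 1) choose (k - 1)"
          using star[of "n - 4"] k 2(2) unfolding sym by simp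
        then have "real ((n - 4) choose (k - 1)) \<le> ?C - hits ?F i" by linarith
        moreover have "u * misses ?F i \<le> v * (?C - hits ?F i)"
          using star_ratio_two[OF F'(1) X F'(2) ij(2) k(1) _ 2(1)] k by (simp add: u_def v_def right_diff_distrib)
        ultimately have "misses ?F i + (1 - v / u) * real ((n - 4) choose (k - 1)) \<le> ?C - hits ?F i"
          using uv by (intro gain_of_ratio) auto
        then show ?thesis using W4 unfolding cF by simp
      next
        case 3
        have sym: "(n - 5) choose (n - 1 - k) = (n - 5) choose (k - 4)"
          using k by (subst binomial_symmetric) (auto intro: arg_cong2[where f = "(choose)"])
        have "((n - 5) choose (k - 1)) + hits ?F i \<le> (n - 1) choose (k - 1)"
          using star[of "n - 5"] k 3(2) unfolding sym by simp
        then have "real ((n - 5) choose (k - 1)) \<le> ?C - hits ?F i" by linarith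
        moreover have "u * u' * misses ?F i \<le> v * v' * (?C - hits ?F i)"
          using star_ratio_three[OF F'(1) X F'(2) ij(2) k(1) _ 3(1)] k
          by (simp add: u_def v_def u'_def v'_def right_diff_distrib)
        moreover have "v * v' \<le> u * u'" using uv by (intro mult_mono) auto
        ultimately have "misses ?F i + W \<le> ?C - hits ?F i"
          unfolding W_def using uv by (intro gain_of_ratio) auto
        then show ?thesis unfolding cF by simp
      next
        case 4
        \<comment> \<open>Members avoiding both points are fixed by the shift, so the small new
          diversity of \<open>i\<close> bounds their number.\<close>
        have "{B \<in> F. i \<notin> B \<and> j \<notin> B} \<subseteq> {B \<in> ?F. i \<notin> B}"
          using in_shift_family_iff[OF ij(1)] by auto
        then have "card {B \<in> F. i \<notin> B \<and> j \<notin> B} \<le> misses ?F i"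
          unfolding misses_def using finite_shift_family[OF finF] by (intro card_mono) auto
        also note 4
        also have "(n - 5) choose (k - 4) \<le> (n - 5) choose (k - 3)"
          using k by (intro binomial_mono) linarith+
        finally have "card {B \<in> F. i \<notin> B \<and> j \<notin> B} \<le> (n - 5) choose (k - 3)" .
        from two_element_split_bound[OF F(1) X F(2) ij(2,3,1) k this F(3)[OF ij(2)] F(3)[OF ij(3)]]
        have "v * real (card F) + (u - v) * real ?g \<le> v * ?C" unfolding uv(7) v_def .
        then show ?thesis by (rule finish)
      qed
    qed
  qed
  then show ?thesis unfolding W_def u_def v_def u'_def v'_def .
qed

section \<open>Degrees of sets\<close>

text \<open>Take \<open>S\<close> disjoint from \<open>x\<close> and from two members
  \<open>A\<close>, \<open>B\<close> avoiding \<open>x\<close>. Members through \<open>S\<close> and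
  \<open>x\<close> must meet both. Meeting \<open>A\<close> already gives the claimed difference of
  binomials; the sets meeting \<open>A\<close> but not \<open>B\<close> are a further saving, large
  enough to pay for the at most \<open>misses F x\<close> members that contain \<open>S\<close> and
  avoid \<open>x\<close>. If \<open>A\<close> is the only member avoiding \<open>x\<close>, nothing
  has to be paid.\<close>

lemma small_diversity_low_degree:
  assumes F: "F \<subseteq> nsets X k" "finite X" "card X = n" "intersecting F" and x: "x \<in> X"
    and t: "1 \<le> t" "t + 2 \<le> k" "2 * k + t \<le> n"
    and m: "1 \<le> misses F x" "misses F x \<le> (n - t - k - 2) choose (k - t - 2)"
  shows "\<exists>S\<in>nsets X t. set_degree F S + ((n - t - k - 1) choose (k - t - 1)) \<le> (n - t - 1) choose (k - t - 1)"
proof -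
  have finF: "finite F" using finite_subset_nsets F by blast
  have sub: "A \<subseteq> X" "card A = k" "finite A" if "A \<in> F" for A
    using that F(1) by (auto simp: nsets_def)
  let ?M = "{A \<in> F. x \<notin> A}"
  have cM: "card ?M = misses F x" by (simp add: misses_def)
  have "?M \<noteq> {}" using m(1) cM by (metis card.empty not_one_le_zero)
  then obtain A where A: "A \<in> F" "x \<notin> A" by blast
  obtain B where B: "B \<in> F" "x \<notin> B" "B \<noteq> A \<or> ?M = {A}"
  proof (cases "?M = {A}")
    case True
    then show ?thesis using A that by blast
  next
    case False
    then obtain B where "B \<in> ?M" "B \<noteq> A" using A by blast
    then show ?thesis using that by blast
  qed
  \<comment> \<open>The common point limits \<open>A \<union> B\<close> to \<open>2 * k - 1\<close>
    points, also if \<open>B = A\<close>, so after removing \<open>x\<close> as well there are still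
    \<open>t\<close> points left for \<open>S\<close>.\<close>
  have "A \<inter> B \<noteq> {}" using F(4) A B unfolding intersecting_def by blast
  then have "1 \<le> card (A \<inter> B)" using sub[OF A(1)] by (simp add: Suc_le_eq card_gt_0_iff)
  moreover have "card A + card B = card (A \<union> B) + card (A \<inter> B)"
    using sub[OF A(1)] sub[OF B(1)] by (intro card_Un_Int) auto
  ultimately have "card (insert x (A \<union> B)) \<le> 2 * k"
    using sub[OF A(1)] sub[OF B(1)] A B by (simp add: card_insert_if)
  moreover have "insert x (A \<union> B) \<subseteq> X" using sub[OF A(1)] sub[OF B(1)] x by blast
  ultimately have "t \<le> card (X - insert x (A \<union> B))"
    using F t sub[OF A(1)] sub[OF B(1)] by (subst card_Diff_subset) auto
  then obtain S where S: "S \<subseteq> X - insert x (A \<union> B)" "card S = t" "finite S"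
    using obtain_subset_with_card_n by metis
  define Y where "Y = X - {x} - S"
  define r where "r = k - t - 1"
  have finY: "finite Y" using F by (simp add: Y_def)
  have cY: "card Y = n - t - 1"
    using F x S unfolding Y_def by (subst card_Diff_subset) auto
  have AY: "A \<subseteq> Y" "B \<subseteq> Y" using sub[OF A(1)] sub[OF B(1)] A B S unfolding Y_def by auto
  let ?all = "{E. E \<subseteq> Y \<and> card E = r}"
  let ?T = "{E \<in> ?all. E \<inter> A \<noteq> {} \<and> E \<inter> B \<noteq> {}}"
  let ?N = "{E. E \<subseteq> Y - A \<and> card E = r}"
  let ?P = "{E \<in> ?all. E \<inter> A \<noteq> {} \<and> E \<inter> B = {}}"
  have fin: "finite ?all" using finY by simp
  have cN: "card ?N = (n - t - k - 1) choose r"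
  proof -
    have "card (Y - A) = n - t - k - 1" using cY AY sub[OF A(1)] finY by (simp add: card_Diff_subset)
    then show ?thesis using n_subsets[of "Y - A" r] finY by simp
  qed
  have "card (?T \<union> ?N \<union> ?P) \<le> card ?all" using fin by (intro card_mono) auto
  also have "card ?all = (n - t - 1) choose r" using n_subsets[OF finY] cY by simp
  also have "card (?T \<union> ?N \<union> ?P) = card ?T + card ?N + card ?P"
    using finY by (subst card_Un_disjoint, (auto)[3], subst card_Un_disjoint) auto
  finally have total: "card ?T + card ?N + card ?P \<le> (n - t - 1) choose r" .
  have with_x: "card {C \<in> F. S \<subseteq> C \<and> x \<in> C} \<le> card ?T"
  proof (rule card_inj_on_le[of "\<lambda>C. C - insert x S"])
    show "inj_on (\<lambda>C. C - insert x S) {C \<in> F. S \<subseteq> C \<and> x \<in> C}"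
      by (rule inj_on_inverseI[where g = "\<lambda>E. E \<union> insert x S"]) auto
    show "(\<lambda>C. C - insert x S) ` {C \<in> F. S \<subseteq> C \<and> x \<in> C} \<subseteq> ?T"
    proof (rule image_subsetI)
      fix C assume C: "C \<in> {C \<in> F. S \<subseteq> C \<and> x \<in> C}"
      then have "C \<inter> A \<noteq> {}" "C \<inter> B \<noteq> {}" using F(4) A B unfolding intersecting_def by blast+
      moreover have "insert x S \<inter> (A \<union> B) = {}" using S A B by auto
      ultimately have "(C - insert x S) \<inter> A \<noteq> {}" "(C - insert x S) \<inter> B \<noteq> {}" by blast+
      moreover have "x \<notin> S" "finite (insert x S)" using S by auto
      then have "card (insert x S) = t + 1" using S by simp
      then have "card (C - insert x S) = r"
        using C \<open>finite (insert x S)\<close> sub[of C] by (subst card_Diff_subset) (auto simp: r_def)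
      moreover have "C - insert x S \<subseteq> Y" using C sub[of C] by (auto simp: Y_def)
      ultimately show "C - insert x S \<in> ?T" by blast
    qed
    show "finite ?T" by (rule finite_subset[OF _ fin]) auto
  qed
  have without_x: "card {C \<in> F. S \<subseteq> C \<and> x \<notin> C} \<le> card ?P"
  proof (cases "?M = {A}")
    case True
    have "\<not> S \<subseteq> A" using S t(1) by (metis DiffD2 One_nat_def UnI1 card.empty insertI2 not_one_le_zero subset_iff subset_empty subsetI)
    then have "{C \<in> F. S \<subseteq> C \<and> x \<notin> C} = {}" using True by blast
    then show ?thesis by (simp only: card.empty)
  next
    case False
    then have "B \<noteq> A" using B by blast
    then have "\<not> A \<subseteq> B" using card_subset_eq[of B A] sub[OF A(1)] sub[OF B(1)] by auto
    then obtain z where z: "z \<in> A" "z \<notin> B" by blast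
    \<comment> \<open>Fixing one point \<open>z\<close> of \<open>A - B\<close> produces members of
      \<open>?P\<close> in exactly the number allowed for the diversity.\<close>
    let ?U = "{U. U \<subseteq> Y - B - {z} \<and> card U = r - 1}"
    have "card (Y - B - {z}) = n - t - k - 2"
      using cY AY sub[OF B(1)] finY z by (simp add: card_Diff_subset card_Diff_singleton_if subset_iff)
    then have "card ?U = (n - t - k - 2) choose (k - t - 2)"
      using n_subsets[of "Y - B - {z}" "r - 1"] finY by (simp add: r_def numeral_2_eq_2)
    moreover have "card ?U \<le> card ?P"
    proof (rule card_inj_on_le[of "insert z"])
      show "inj_on (insert z) ?U" by (rule inj_on_inverseI[where g = "\<lambda>E. E - {z}"]) auto
      show "insert z ` ?U \<subseteq> ?P"
      proof (rule image_subsetI)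
        fix U assume U: "U \<in> ?U"
        then have "finite U" "z \<notin> U" using finY finite_subset by blast+
        then show "insert z U \<in> ?P" using U z AY t(2) by (auto simp: r_def)
      qed
      show "finite ?P" by (rule finite_subset[OF _ fin]) auto
    qed
    moreover have "card {C \<in> F. S \<subseteq> C \<and> x \<notin> C} \<le> card ?M" using finF by (intro card_mono) auto
    ultimately show ?thesis using m(2) cM by linarith
  qed
  have "set_degree F S = card ({C \<in> F. S \<subseteq> C \<and> x \<in> C} \<union> {C \<in> F. S \<subseteq> C \<and> x \<notin> C})"
    unfolding set_degree_def by (rule arg_cong[where f = card]) auto
  also have "\<dots> = card {C \<in> F. S \<subseteq> C \<and> x \<in> C} + card {C \<in> F. S \<subseteq> C \<and> x \<notin> C}"
    using finF by (intro card_Un_disjoint) auto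
  finally have "set_degree F S + ((n - t - k - 1) choose (k - t - 1)) \<le> (n - t - 1) choose (k - t - 1)"
    using with_x without_x total cN unfolding r_def by linarith
  moreover have "S \<in> nsets X t" using S by (auto simp: nsets_def)
  ultimately show ?thesis by blast
qed

section \<open>Averages of degrees\<close>

lemma sum_set_degree:
  assumes "finite Y" "finite F" "\<And>A. A \<in> F \<Longrightarrow> finite A"
  shows "(\<Sum>S\<in>nsets Y t. set_degree F S) = (\<Sum>A\<in>F. card (A \<inter> Y) choose t)"
proof -
  have "(\<Sum>S\<in>nsets Y t. set_degree F S) = (\<Sum>S\<in>nsets Y t. \<Sum>A | A \<in> F \<and> S \<subseteq> A. 1)"
    by (simp add: set_degree_def)
  also have "\<dots> = (\<Sum>A\<in>F. \<Sum>S | S \<in> nsets Y t \<and> S \<subseteq> A. 1)"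
    using assms by (intro sum.swap_restrict) (auto simp: finite_imp_finite_nsets)
  also have "\<dots> = (\<Sum>A\<in>F. card (A \<inter> Y) choose t)"
  proof (rule sum.cong)
    fix A assume "A \<in> F"
    then have fin: "finite (A \<inter> Y)" using assms(3) by blast
    have "{S. S \<in> nsets Y t \<and> S \<subseteq> A} = {S. S \<subseteq> A \<inter> Y \<and> card S = t}"
      using fin finite_subset[OF _ fin] by (auto simp: nsets_def)
    then show "(\<Sum>S | S \<in> nsets Y t \<and> S \<subseteq> A. 1) = card (A \<inter> Y) choose t"
      using n_subsets[OF fin] by simp
  qed simp
  finally show ?thesis .
qed

text \<open>Leaving \<open>x\<close> out makes members through \<open>x\<close> count only
  \<open>(k - 1) choose t\<close> times, which matches the degrees in a full star. The bound
  \<open>c - d\<close> on the degrees is kept in additive form because subtraction of natural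
  numbers truncates.\<close>

lemma average_degree_avoiding:
  assumes F: "F \<subseteq> nsets X k" "finite X" "card X = n" and x: "x \<in> X" and t: "t < n"
    and deg: "\<And>S. S \<in> nsets X t \<Longrightarrow> c < set_degree F S + d"
  shows "((n - 1) choose t) * c < misses F x * (k choose t) + hits F x * ((k - 1) choose t) + ((n - 1) choose t) * d"
proof -
  have finF: "finite F" using finite_subset_nsets F by blast
  have sub: "A \<subseteq> X" "card A = k" "finite A" if "A \<in> F" for A
    using that F(1) by (auto simp: nsets_def)
  let ?Y = "X - {x}"
  have cS: "card (nsets ?Y t) = (n - 1) choose t" using F x by (simp add: card_nsets)
  have "nsets ?Y t \<noteq> {}"
  proof
    assume "nsets ?Y t = {}"
    then have "(n - 1) choose t = 0" using cS by simp
    then show False using t by simp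
  qed
  then have "(\<Sum>S\<in>nsets ?Y t. c) < (\<Sum>S\<in>nsets ?Y t. set_degree F S + d)"
    using F(2) nsets_mono[of ?Y X t] by (intro sum_strict_mono deg) (auto simp: finite_imp_finite_nsets)
  also have "\<dots> = (\<Sum>A\<in>F. card (A \<inter> ?Y) choose t) + ((n - 1) choose t) * d"
    using sum_set_degree[of ?Y F t] F(2) finF sub cS by (simp add: sum.distrib)
  also have "(\<Sum>A\<in>F. card (A \<inter> ?Y) choose t) = (\<Sum>A\<in>F. if x \<in> A then (k - 1) choose t else k choose t)"
  proof (rule sum.cong)
    fix A assume A: "A \<in> F"
    have "A \<inter> ?Y = A - {x}" using sub[OF A] by auto
    then show "card (A \<inter> ?Y) choose t = (if x \<in> A then (k - 1) choose t else k choose t)"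
      using sub[OF A] by (simp add: card_Diff_singleton_if)
  qed simp
  also have "\<dots> = hits F x * ((k - 1) choose t) + misses F x * (k choose t)"
    using finF by (subst sum.If_cases) (auto simp: hits_def misses_def Int_def)
  finally show ?thesis using cS by simp
qed

lemma average_degree:
  assumes F: "F \<subseteq> nsets X k" "finite X" "card X = n" and t: "t \<le> n"
    and deg: "\<And>S. S \<in> nsets X t \<Longrightarrow> c < set_degree F S + d"
  shows "(n choose t) * c < card F * (k choose t) + (n choose t) * d"
proof -
  have finF: "finite F" using finite_subset_nsets F by blast
  have sub: "A \<subseteq> X" "card A = k" "finite A" if "A \<in> F" for A
    using that F(1) by (auto simp: nsets_def)
  have cS: "card (nsets X t) = n choose t" using F by (simp add: card_nsets)
  have "nsets X t \<noteq> {}"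
  proof
    assume "nsets X t = {}"
    then have "n choose t = 0" using cS by simp
    then show False using t by simp
  qed
  then have "(\<Sum>S\<in>nsets X t. c) < (\<Sum>S\<in>nsets X t. set_degree F S + d)"
    using F(2) by (intro sum_strict_mono deg) (auto simp: finite_imp_finite_nsets)
  also have "\<dots> = (\<Sum>A\<in>F. card (A \<inter> X) choose t) + (n choose t) * d"
    using sum_set_degree[of X F t] F(2) finF sub cS by (simp add: sum.distrib)
  also have "(\<Sum>A\<in>F. card (A \<inter> X) choose t) = (\<Sum>A\<in>F. k choose t)"
    using sub by (intro sum.cong) (auto simp: Int_absorb2)
  finally show ?thesis using cS by simp
qed

section \<open>Binomial estimates\<close>

lemma binomial_step_le:
  assumes "5 * r \<le> Suc P"
  shows "4 * (Suc P choose r) \<le> 5 * (P choose r)"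
proof -
  have "(real (Suc P) - real r) * real (Suc P choose r) = real (Suc P) * real (P choose r)"
    using binomial_pred_ratio[of r "Suc P"] assms by simp
  moreover have "4 * real (Suc P) * real (Suc P choose r) \<le> 5 * (real (Suc P) - real r) * real (Suc P choose r)"
    using assms by (intro mult_right_mono) auto
  ultimately have "real (Suc P) * (4 * real (Suc P choose r)) \<le> real (Suc P) * (5 * real (P choose r))"
    by (simp only: mult_ac)
  then have "4 * real (Suc P choose r) \<le> 5 * real (P choose r)"
    by (simp only: mult_le_cancel_left_pos of_nat_0_less_iff zero_less_Suc)
  then show ?thesis by linarith
qed

text \<open>Three steps of the top cost at most \<open>(5 / 4) ^ 3 = 125 / 64\<close>, and one step
  of the bottom gains \<open>(P - r) / (r + 1)\<close>, which is no smaller under the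
  hypotheses.\<close>

lemma binomial_drop_three:
  assumes "5 * r \<le> P" "5 \<le> P"
  shows "(P + 3) choose r \<le> P choose Suc r"
proof -
  have "4 * (Suc P choose r) \<le> 5 * (P choose r)"
    "4 * (Suc (Suc P) choose r) \<le> 5 * (Suc P choose r)"
    "4 * (Suc (Suc (Suc P)) choose r) \<le> 5 * (Suc (Suc P) choose r)"
    using assms by (auto intro!: binomial_step_le simp del: binomial_Suc_Suc)
  then have "64 * ((P + 3) choose r) \<le> 125 * (P choose r)"
    by (simp add: numeral_3_eq_3 del: binomial_Suc_Suc)
  then have 1: "64 * real ((P + 3) choose r) \<le> 125 * real (P choose r)" by linarith
  have "real (5 * r) \<le> real P" "real 5 \<le> real P" using assms by (simp_all only: of_nat_le_iff)
  then have "125 * (real r + 1) \<le> 64 * (real P - real r)" by simp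
  then have "125 * (real r + 1) * real (P choose r) \<le> 64 * (real P - real r) * real (P choose r)"
    by (rule mult_right_mono) simp
  also have "\<dots> = 64 * (real (Suc r) * real (P choose Suc r))" by (simp only: binomial_Suc_ratio mult.assoc)
  finally have "(real r + 1) * (125 * real (P choose r)) \<le> (real r + 1) * (64 * real (P choose Suc r))"
    by (simp add: algebra_simps)
  then have "125 * real (P choose r) \<le> 64 * real (P choose Suc r)" by (simp add: mult_le_cancel_left)
  then show ?thesis using 1 by linarith
qed

lemma binomial_drop_three_iterate:
  assumes "5 * (r + s) \<le> P + 5" "5 \<le> P"
  shows "(P + 3 * s) choose r \<le> P choose (r + s)"
  using assms
proof (induction s arbitrary: P)
  case (Suc s)
  have "((P + 3) + 3 * s) choose r \<le> (P + 3) choose (r + s)" using Suc.prems by (intro Suc.IH) auto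
  also have "\<dots> \<le> P choose Suc (r + s)" using Suc.prems by (intro binomial_drop_three) auto
  finally show ?case by (simp add: algebra_simps)
qed simp

text \<open>Serves \<open>t = 1\<close>. For \<open>n = 2 * k + 5\<close> and
  \<open>P = n - k - 3\<close> the target \<open>P choose (k - 3)\<close> equals
  \<open>P choose 5\<close>, so the bottom can rise by one only. That single rise gains at least
  \<open>33 / 5\<close> and pays for six steps of the top, which cost at most
  \<open>(5 / 4) ^ 6 < 4\<close>.\<close>

lemma binomial_drop_six:
  assumes "37 \<le> P"
  shows "(P + 6) choose 4 \<le> P choose 5"
proof -
  define f where "f i = (P + i) choose 4" for i
  have step: "4 * f (Suc i) \<le> 5 * f i" for i
    using binomial_step_le[of 4 "P + i"] assms unfolding f_def by (simp del: binomial_Suc_Suc)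
  have "4 * f 1 \<le> 5 * f 0" "4 * f 2 \<le> 5 * f 1" "4 * f 3 \<le> 5 * f 2" "4 * f 4 \<le> 5 * f 3"
    "4 * f 5 \<le> 5 * f 4" "4 * f 6 \<le> 5 * f 5"
    using step[of 0] step[of 1] step[of 2] step[of 3] step[of 4] step[of 5]
    by (simp_all add: eval_nat_numeral)
  then have "4096 * f 6 \<le> 15625 * f 0" by linarith
  then have "4096 * ((P + 6) choose 4) \<le> 15625 * (P choose 4)" by (simp add: f_def)
  then have 1: "4096 * real ((P + 6) choose 4) \<le> 15625 * real (P choose 4)" by linarith
  have "real (Suc 4) * real (P choose Suc 4) = (real P - real 4) * real (P choose 4)"
    by (rule binomial_Suc_ratio)
  then have "5 * real (P choose 5) = (real P - 4) * real (P choose 4)" by simp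
  moreover have "33 * real (P choose 4) \<le> (real P - 4) * real (P choose 4)"
    using assms by (intro mult_right_mono) auto
  ultimately show ?thesis using 1 by linarith
qed

lemma binomial_le_middle:
  assumes "q \<le> s" "q \<le> P - s" "s \<le> P"
  shows "P choose q \<le> P choose s"
proof (cases "2 * s \<le> P")
  case True
  then show ?thesis using assms by (intro binomial_mono)
next
  case False
  then have "P choose q \<le> P choose (P - s)" using assms by (intro binomial_mono) auto
  then show ?thesis using binomial_symmetric[OF assms(3)] by simp
qed

text \<open>Closes the gap between the two treatments of diversity: from the left side on averaging
  works, up to the right side there is a \<open>t\<close>-set of small degree. Trading three steps
  of the top for one of the bottom, \<open>t + 1\<close> times, leads from one binomial towards the
  middle of the row of the other.\<close>

lemma diversity_threshold:
  fixes n k t :: nat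
  assumes "(t = 1 \<and> 35 \<le> k \<and> 2 * k + 5 \<le> n) \<or> (2 \<le> t \<and> 4 * t + 8 \<le> k \<and> 2 * k + 14 * t \<le> n)"
  shows "(n - k + 2 * t + 1) choose (2 * t + 2) \<le> (n - t - k - 2) choose (k - t - 2)"
proof -
  have "t + k + 2 \<le> n" using assms by linarith
  then obtain P where n: "n = t + k + 2 + P" using le_Suc_ex by blast
  then have P: "n - t - k - 2 = P" "n - k + 2 * t + 1 = P + 3 * (t + 1)" by simp_all
  from assms show ?thesis
  proof (elim disjE conjE)
    assume t: "t = 1" "35 \<le> k" "2 * k + 5 \<le> n"
    have "(P + 6) choose 4 \<le> P choose 5" using t n by (intro binomial_drop_six) linarith
    also have "\<dots> \<le> P choose (k - t - 2)" using t n by (intro binomial_le_middle) linarith+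
    finally show ?thesis using t(1) unfolding P by simp
  next
    assume t: "2 \<le> t" "4 * t + 8 \<le> k" "2 * k + 14 * t \<le> n"
    have "5 * (2 * t + 2 + (t + 1)) \<le> P + 5" using t n by simp
    moreover have "5 \<le> P" using t n by simp
    ultimately have "(P + 3 * (t + 1)) choose (2 * t + 2) \<le> P choose (2 * t + 2 + (t + 1))"
      by (rule binomial_drop_three_iterate)
    also have "\<dots> \<le> P choose (k - t - 2)" using t n by (intro binomial_le_middle) linarith+
    finally show ?thesis unfolding P .
  qed
qed

section \<open>Quotients of binomial coefficients bounded by powers\<close>

text \<open>Raising the top from \<open>N + j\<close> by one multiplies by
  \<open>1 + r / (N + j + 1 - r)\<close>; the last denominator, \<open>N + J - r\<close>, serves as
  a common lower estimate for all steps.\<close>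

lemma binomial_growth_lower:
  assumes "r \<le> N" "j \<le> J"
  shows "(1 + real r / real (N + J - r)) ^ j * real (N choose r) \<le> real ((N + j) choose r)"
  using assms
proof (induction j)
  case (Suc j)
  let ?q = "1 + real r / real (N + J - r)"
  have pos: "0 < real (Suc (N + j)) - real r" "real (Suc (N + j)) - real r \<le> real (N + J - r)"
    using Suc.prems by (auto simp: of_nat_diff)
  then have "real r / real (N + J - r) \<le> real r / (real (Suc (N + j)) - real r)"
    by (intro divide_left_mono) auto
  then have "?q \<le> 1 + real r / (real (Suc (N + j)) - real r)" by (rule add_left_mono)
  also have "1 + real r / (real (Suc (N + j)) - real r) = real (Suc (N + j)) / (real (Suc (N + j)) - real r)"
    using pos by (simp add: field_simps)
  finally have q: "?q \<le> real (Suc (N + j)) / (real (Suc (N + j)) - real r)" .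
  have "?q ^ Suc j * real (N choose r) \<le> ?q * real ((N + j) choose r)"
    using Suc by (simp add: mult.assoc mult_left_mono)
  also have "\<dots> \<le> real (Suc (N + j)) / (real (Suc (N + j)) - real r) * real ((N + j) choose r)"
    using q by (rule mult_right_mono) simp
  also have "\<dots> = real (Suc (N + j) choose r)"
    using binomial_pred_ratio[of r "Suc (N + j)"] Suc.prems pos by (simp add: field_simps del: of_nat_Suc)
  finally show ?case by simp
qed simp

text \<open>Compares the numerators \<open>N + k - i\<close> and \<open>N - i\<close> factor by
  factor; for \<open>i < T\<close> the quotient is largest at \<open>i = T - 1\<close>.\<close>

lemma binomial_shift_upper:
  assumes "T \<le> N" "s \<le> T"
  shows "real ((N + k) choose s) \<le> (1 + real k / (real N + 1 - real T)) ^ s * real (N choose s)"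
  using assms
proof (induction s)
  case (Suc s)
  let ?q = "1 + real k / (real N + 1 - real T)"
  have pos: "0 < real N + 1 - real T" "real N + 1 - real T \<le> real N - real s" using Suc.prems by auto
  have q: "real (N + k) - real s \<le> ?q * (real N - real s)"
  proof -
    have "real k * (real N + 1 - real T) \<le> real k * (real N - real s)"
      using pos by (intro mult_left_mono) auto
    then have "real k \<le> real k / (real N + 1 - real T) * (real N - real s)" using pos by (simp add: field_simps)
    then show ?thesis by (simp add: algebra_simps)
  qed
  have "real (Suc s) * real ((N + k) choose Suc s) = (real (N + k) - real s) * real ((N + k) choose s)"
    by (rule binomial_Suc_ratio)
  also have "\<dots> \<le> (?q * (real N - real s)) * (?q ^ s * real (N choose s))"
    using q Suc pos by (intro mult_mono) auto
  also have "\<dots> = ?q ^ Suc s * ((real N - real s) * real (N choose s))" by (simp only: power_Suc mult_ac)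
  also have "\<dots> = real (Suc s) * (?q ^ Suc s * real (N choose Suc s))"
    unfolding binomial_Suc_ratio[symmetric] by (simp only: mult_ac)
  finally show ?case by (simp only: mult_le_cancel_left_pos of_nat_0_less_iff zero_less_Suc)
qed simp

lemma binomial_shift_lower:
  assumes "s \<le> N" "0 < c" "real N \<le> c"
  shows "(1 + real k / c) ^ s * real (N choose s) \<le> real ((N + k) choose s)"
  using assms(1)
proof (induction s)
  case (Suc s)
  let ?q = "1 + real k / c"
  have pos: "0 < real N - real s" "real N - real s \<le> c" using Suc.prems assms(3) by auto
  have q: "?q * (real N - real s) \<le> real (N + k) - real s"
  proof -
    have "real k * (real N - real s) \<le> real k * c" using pos by (intro mult_left_mono) auto
    then have "real k / c * (real N - real s) \<le> real k" using assms(2) by (simp add: field_simps)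
    then show ?thesis by (simp add: algebra_simps)
  qed
  have "real (Suc s) * (?q ^ Suc s * real (N choose Suc s)) = ?q ^ Suc s * ((real N - real s) * real (N choose s))"
    unfolding binomial_Suc_ratio[symmetric] by (simp only: mult_ac)
  also have "\<dots> = (?q * (real N - real s)) * (?q ^ s * real (N choose s))" by (simp only: power_Suc mult_ac)
  also have "\<dots> \<le> (real (N + k) - real s) * real ((N + k) choose s)"
    using q Suc pos by (intro mult_mono) (auto simp: assms(2) less_imp_le)
  also have "\<dots> = real (Suc s) * real ((N + k) choose Suc s)" by (rule binomial_Suc_ratio[symmetric])
  finally show ?case by (simp only: mult_le_cancel_left_pos of_nat_0_less_iff zero_less_Suc)
qed simp

text \<open>The binomial expansion cut after four terms. Multiplying by \<open>1 + x\<close>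
  overshoots the next truncation only by the term in \<open>x ^ 4\<close>, whose coefficient is
  nonnegative because \<open>m\<close> is a natural number.\<close>

lemma power_lower_cubic:
  fixes x :: real
  assumes "0 \<le> x"
  shows "1 + m * x + m * (m - 1) / 2 * x\<^sup>2 + m * (m - 1) * (m - 2) / 6 * x ^ 3 \<le> (1 + x) ^ m"
proof (induction m)
  case (Suc m)
  let ?p = "\<lambda>m :: real. 1 + m * x + m * (m - 1) / 2 * x\<^sup>2 + m * (m - 1) * (m - 2) / 6 * x ^ 3"
  have nn: "0 \<le> real m * (real m - 1) * (real m - 2)"
  proof -
    consider "m = 0" | "m = 1" | "2 \<le> m" by linarith
    then show ?thesis by cases auto
  qed
  have "?p (real m + 1) = (1 + x) * ?p m - real m * (real m - 1) * (real m - 2) / 6 * x ^ 4"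
    by (simp add: field_simps power2_eq_square power3_eq_cube power4_eq_xxxx)
  also have "\<dots> \<le> (1 + x) * ?p m" using nn assms by simp
  also have "\<dots> \<le> (1 + x) * (1 + x) ^ m" using Suc assms by (intro mult_left_mono) auto
  finally show ?case by (simp add: add.commute)
qed simp

text \<open>Here \<open>d\<close> stands for \<open>n - 2 * k\<close>. For \<open>t \<ge> 2\<close>
  each factor on the left is at most \<open>(1 + a)\<^sup>2\<close>, which consumes
  \<open>2 * t\<close> of the \<open>2 * t + 2\<close> factors on the right; the last two compensate
  \<open>E / G\<close>, which is the final factor. For \<open>t = 1\<close> the fourth power is
  expanded up to its quadratic term.\<close>

lemma power_comparison:
  fixes k d :: real and t :: nat
  assumes "(t = 1 \<and> 35 \<le> k \<and> 5 \<le> d) \<or> (2 \<le> t \<and> 4 * real t + 8 \<le> k \<and> 14 * real t \<le> d)"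
  shows "(1 + k / (k + d - t)) ^ t
      \<le> (1 + (k - 1) / (d + 2 * real t + 2)) ^ (2 * t + 2) * (1 - k * (k - 1) / ((k - t) * (k + d - 1)))"
    and "0 < 1 - k * (k - 1) / ((k - t) * (k + d - 1))"
proof -
  define a where "a = (k - 1) / (d + 2 * real t + 2)"
  define E where "E = k * d - k * t - d * t + t"
  define G where "G = (k - t) * (k + d - 1)"
  have GE: "G = E + k * (k - 1)" by (simp add: G_def E_def algebra_simps)
  have basic: "1 \<le> t" "t < k" "0 < k" "0 < d" "0 < k - 1" using assms by auto
  have a0: "0 < a" using basic by (simp add: a_def)
  have E0: "0 < E"
    using assms
  proof (elim disjE conjE)
    assume t: "t = 1" "35 \<le> k" "5 \<le> d"
    then have "E = (k - 1) * (d - 1)" by (simp add: E_def algebra_simps)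
    then show ?thesis using t by simp
  next
    assume t: "2 \<le> t" "4 * real t + 8 \<le> k" "14 * real t \<le> d"
    have "14 * (k * t) \<le> k * d" using mult_left_mono[OF t(3), of k] basic by (simp add: mult.left_commute)
    moreover have "4 * (d * t) + 8 * d \<le> k * d" using mult_right_mono[OF t(2), of d] basic by (simp add: algebra_simps)
    moreover have "0 < k * d" using basic by simp
    ultimately show ?thesis using basic unfolding E_def by linarith
  qed
  have G0: "0 < G" using GE E0 basic by (simp add: add_pos_pos)
  have kap: "1 - k * (k - 1) / G = E / G" using G0 GE by (simp add: field_simps)
  then show "0 < 1 - k * (k - 1) / ((k - t) * (k + d - 1))" using E0 G0 unfolding G_def by simp
  have "(1 + k / (k + d - t)) ^ t \<le> (1 + a) ^ (2 * t + 2) * (E / G)"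
    using assms
  proof (elim disjE conjE)
    assume t: "t = 1" "35 \<le> k" "5 \<le> d"
    have a: "a = (k - 1) / (d + 4)" using t by (simp add: a_def)
    have quart: "1 + 4 * a + 6 * a\<^sup>2 \<le> (1 + a) ^ 4"
    proof -
      have "(1 + a) ^ 4 = 1 + 4 * a + 6 * a\<^sup>2 + (4 * a ^ 3 + a ^ 4)"
        by (simp add: power2_eq_square power3_eq_cube power4_eq_xxxx algebra_simps)
      then show ?thesis using a0 by simp
    qed
    have "2 * k * (d + 4)\<^sup>2 \<le> (4 * (k - 1) * (d + 4) + 6 * (k - 1)\<^sup>2) * (d - 1)"
    proof -
      \<comment> \<open>Measured from the corner \<open>d = 5\<close>, \<open>k = 35\<close>, the
        difference of the two sides is a polynomial with nonnegative coefficients.\<close>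
      obtain e j where ej: "d = 5 + e" "0 \<le> e" "k = 35 + j" "0 \<le> j"
        using t by (metis add.commute diff_add_cancel diff_ge_0_iff_ge)
      show ?thesis unfolding ej using ej(2,4)
        by (simp add: power2_eq_square algebra_simps add_nonneg_nonneg)
    qed
    then have "2 * k \<le> (4 * (k - 1) * (d + 4) + 6 * (k - 1)\<^sup>2) * (d - 1) / (d + 4)\<^sup>2"
      using t by (subst pos_le_divide_eq) auto
    also have "\<dots> = (4 * (k - 1) * (d + 4) + 6 * (k - 1)\<^sup>2) / (d + 4)\<^sup>2 * (d - 1)" by simp
    also have "(4 * (k - 1) * (d + 4) + 6 * (k - 1)\<^sup>2) / (d + 4)\<^sup>2 = 4 * a + 6 * a\<^sup>2"
      using t unfolding a by (simp add: add_divide_distrib power2_eq_square)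
    finally have "2 * k \<le> (4 * a + 6 * a\<^sup>2) * (d - 1)" .
    then have "2 * k + d - 1 \<le> (1 + 4 * a + 6 * a\<^sup>2) * (d - 1)" by (simp add: algebra_simps)
    also have "\<dots> \<le> (1 + a) ^ 4 * (d - 1)" using quart t by (intro mult_right_mono) auto
    finally have "(2 * k + d - 1) / (k + d - 1) \<le> (1 + a) ^ 4 * (d - 1) / (k + d - 1)"
      using t by (intro divide_right_mono) auto
    moreover have "E = (k - 1) * (d - 1)" "G = (k - 1) * (k + d - 1)"
      using t by (simp_all add: E_def G_def algebra_simps)
    then have "E / G = (d - 1) / (k + d - 1)" using t by simp
    moreover have "1 + k / (k + d - 1) = (2 * k + d - 1) / (k + d - 1)" using t by (simp add: field_simps)
    ultimately show ?thesis using t(1) by simp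
  next
    assume t: "2 \<le> t" "4 * real t + 8 \<le> k" "14 * real t \<le> d"
    have sq: "1 + 2 * a \<le> (1 + a)\<^sup>2" by (simp add: power2_eq_square algebra_simps)
    have "k * (d + 2 * real t + 2) \<le> 2 * (k - 1) * (k + d - t)"
    proof -
      have "2 * (k - 1) * (k + d - t) - k * (d + 2 * real t + 2) = (k - 2) * d + 2 * k * (k - 2 * real t - 2) + 2 * real t"
        by (simp add: algebra_simps)
      moreover have "0 \<le> (k - 2) * d" "0 \<le> 2 * k * (k - 2 * real t - 2)" using t basic by simp_all
      ultimately show ?thesis by simp
    qed
    then have "k / (k + d - t) \<le> 2 * a" using basic unfolding a_def by (simp add: field_simps)
    then have b: "1 + k / (k + d - t) \<le> (1 + a)\<^sup>2" using sq by linarith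
    have one: "1 \<le> (1 + a)\<^sup>2 * (E / G)"
    proof -
      have "k * (d + 2 * real t + 2) \<le> 2 * E"
      proof -
        have "14 * (k * t) \<le> k * d" using mult_left_mono[OF t(3), of k] basic by (simp add: mult.left_commute)
        moreover have "4 * (d * t) + 8 * d \<le> k * d" using mult_right_mono[OF t(2), of d] basic by (simp add: algebra_simps)
        moreover have "2 * k \<le> k * t" using t(1) basic by simp
        moreover have "k * (d + 2 * real t + 2) = k * d + 2 * (k * real t) + 2 * k" by (simp add: algebra_simps)
        ultimately show ?thesis using basic unfolding E_def distrib_left right_diff_distrib by linarith
      qed
      then have "(k - 1) * (k * (d + 2 * real t + 2)) \<le> (k - 1) * (2 * E)" using basic by (intro mult_left_mono) auto
      then have "G * (d + 2 * real t + 2) \<le> (d + 2 * real t + 2 + 2 * (k - 1)) * E"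
        unfolding GE by (simp add: algebra_simps)
      then have "G \<le> (d + 2 * real t + 2 + 2 * (k - 1)) * E / (d + 2 * real t + 2)"
        using basic by (simp add: pos_le_divide_eq)
      also have "\<dots> = (1 + 2 * a) * E" using basic unfolding a_def by (simp add: field_simps)
      also have "\<dots> \<le> (1 + a)\<^sup>2 * E" using sq E0 by (intro mult_right_mono) auto
      finally show ?thesis using G0 by (simp add: pos_le_divide_eq)
    qed
    have "(1 + k / (k + d - t)) ^ t \<le> ((1 + a)\<^sup>2) ^ t" using b basic by (intro power_mono) auto
    also have "\<dots> \<le> ((1 + a)\<^sup>2) ^ t * ((1 + a)\<^sup>2 * (E / G))"
      using mult_left_mono[OF one, of "((1 + a)\<^sup>2) ^ t"] by simp
    also have "\<dots> = (1 + a) ^ (2 * t + 2) * (E / G)" by (simp add: power_add power_mult mult.assoc power2_eq_square)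
    finally show ?thesis .
  qed
  then show "(1 + k / (k + d - t)) ^ t
      \<le> (1 + (k - 1) / (d + 2 * real t + 2)) ^ (2 * t + 2) * (1 - k * (k - 1) / ((k - t) * (k + d - 1)))"
    using kap unfolding a_def G_def by simp
qed

section \<open>The real inequalities behind averaging over all \<open>t\<close>-sets\<close>

text \<open>The left side is the numerator of \<open>1 - w\<close> in the two inequalities below,
  and the right side is its homogeneous cubic part; the terms of lower degree are not positive in
  total.\<close>

lemma gain_complement_upper:
  fixes k d :: real
  assumes "4 \<le> k" "4 \<le> d"
  shows "(2 * k + d - 1) * (2 * k + d - 2) * (2 * k + d - 4) - d * (k + d) * (k + d - 3)
    \<le> k * (8 * k\<^sup>2 + 11 * k * d + 4 * d\<^sup>2)"
proof -
  obtain i j where "k = 4 + i" "0 \<le> i" "d = 4 + j" "0 \<le> j"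
    using assms by (metis add.commute diff_add_cancel diff_ge_0_iff_ge)
  then show ?thesis by (simp add: power2_eq_square algebra_simps add_nonneg_nonneg)
qed

text \<open>With \<open>d = n - 2 * k\<close>, \<open>w\<close> is the share of
  \<open>(n - 1) choose (k - 1)\<close> that the large-diversity bound saves,
  \<open>\<theta>\<close> the share lost by averaging over all \<open>t\<close>-sets rather than
  inside a star, and the cubic in \<open>x\<close> a lower bound for \<open>D / N - 1\<close>, where
  \<open>D\<close> and \<open>N\<close> are the two binomials of the theorem. This is the case
  \<open>t = 1\<close>.\<close>

lemma averaging_inequality_one:
  fixes k d :: real
  assumes k: "35 \<le> k" and d: "5 \<le> d"
  defines "w \<equiv> d * (k + d) * (k + d - 3) / ((2 * k + d - 1) * (2 * k + d - 2) * (2 * k + d - 4))"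
    and "\<theta> \<equiv> (k + d) / (k * (2 * k + d - 1))" and "x \<equiv> k / (k + d)" and "m \<equiv> k - 2"
  shows "1 - w \<le> (m * x + m * (m - 1) / 2 * x\<^sup>2 + m * (m - 1) * (m - 2) / 6 * x ^ 3) * (w - \<theta>)"
    and "\<theta> < w"
proof -
  define A where "A = (2 * k + d - 1) * (2 * k + d - 2) * (2 * k + d - 4)"
  define s where "s = k + d"
  define R where "R = 8 * k\<^sup>2 + 11 * k * d + 4 * d\<^sup>2"
  define Q where "Q = s\<^sup>2 + (k - 3) * k * s / 2 + (k - 3) * (k - 4) * k\<^sup>2 / 6"
  have A0: "0 < A" and s0: "0 < s" using k d by (auto simp: A_def s_def)
  \<comment> \<open>The factor \<open>d - 4\<close> makes \<open>w > \<theta>\<close> depend on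
    \<open>d > 4\<close>; this is where \<open>n \<ge> 2 * k + 5\<close> enters.\<close>
  have diff: "w - \<theta> = s * (d - 4) * (k - 1) * (s - 2) / (k * A)"
  proof -
    have "\<theta> = s * ((2 * k + d - 2) * (2 * k + d - 4)) / (k * A)"
    proof -
      have "2 * k + d - 2 \<noteq> 0" "2 * k + d - 4 \<noteq> 0" using k d by simp_all
      then show ?thesis unfolding \<theta>_def A_def s_def by (simp add: mult.assoc)
    qed
    moreover have "w = d * s * (s - 3) * k / (k * A)"
      unfolding w_def A_def[symmetric] s_def[symmetric] using k by simp
    moreover have "d * s * (s - 3) * k - s * ((2 * k + d - 2) * (2 * k + d - 4)) = s * (d - 4) * (k - 1) * (s - 2)"
      by (simp add: s_def algebra_simps)
    ultimately show ?thesis by (metis diff_divide_distrib)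
  qed
  have "0 < s * (d - 4) * (k - 1) * (s - 2) / (k * A)" using A0 k d by (simp add: s_def)
  then show "\<theta> < w" using diff by simp
  have S: "m * x + m * (m - 1) / 2 * x\<^sup>2 + m * (m - 1) * (m - 2) / 6 * x ^ 3 = k * (k - 2) * Q / s ^ 3"
    using s0 by (simp add: m_def x_def Q_def s_def[symmetric] divide_simps power2_eq_square power3_eq_cube)
      (simp add: algebra_simps)
  have "w = d * s * (s - 3) / A" by (simp add: w_def A_def s_def)
  then have "1 - w = (A - d * s * (s - 3)) / A" using A0 by (simp add: diff_divide_distrib)
  also have "\<dots> \<le> k * R / A"
    using gain_complement_upper[of k d] k d A0 by (intro divide_right_mono) (auto simp: A_def s_def R_def)
  also have "\<dots> \<le> k * (k - 2) * Q / s ^ 3 * (s * (d - 4) * (k - 1) * (s - 2) / (k * A))"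
  proof -
    \<comment> \<open>From \<open>k \<ge> 35\<close> comes the factor \<open>637 / 20\<close>, from
      \<open>s \<ge> 40\<close> the factor \<open>19 / 20\<close>; their product just exceeds
      30.\<close>
    have 1: "30 * k * s \<le> (k - 2) * (k - 1) * (s - 2)"
    proof -
      have "637 / 20 * k \<le> (k - 2) * (k - 1)"
      proof -
        have "35 * k \<le> k * k" using k by simp
        moreover have "(k - 2) * (k - 1) = k * k - 3 * k + 2" by (simp add: algebra_simps)
        ultimately show ?thesis using k by linarith
      qed
      moreover have "19 / 20 * s \<le> s - 2" using k d by (simp add: s_def)
      moreover have "0 \<le> (k - 2) * (k - 1)" "0 \<le> 19 / 20 * s" using k s0 by simp_all
      ultimately have "(637 / 20 * k) * (19 / 20 * s) \<le> (k - 2) * (k - 1) * (s - 2)"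
        by (rule mult_mono)
      moreover have "30 * k * s \<le> (637 / 20 * k) * (19 / 20 * s)" using k s0 by simp
      ultimately show ?thesis by linarith
    qed
    have 2: "R * s \<le> 30 * (d - 4) * Q"
    proof -
      have q1: "16 * k * s \<le> (k - 3) * k * s / 2" using k s0 by simp
      have q2: "4 * k ^ 3 \<le> (k - 3) * (k - 4) * k\<^sup>2 / 6"
      proof -
        have "24 * k \<le> (k - 3) * (k - 4)"
        proof -
          have "35 * k \<le> k * k" using k by simp
          moreover have "(k - 3) * (k - 4) = k * k - 7 * k + 12" by (simp add: algebra_simps)
          ultimately show ?thesis using k by linarith
        qed
        then have "24 * k * k\<^sup>2 \<le> (k - 3) * (k - 4) * k\<^sup>2" by (intro mult_right_mono) auto
        then show ?thesis by (simp add: power2_eq_square power3_eq_cube)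
      qed
      have Q1: "d\<^sup>2 + 16 * k * d + 16 * k\<^sup>2 + 4 * k ^ 3 \<le> Q"
      proof -
        have "s\<^sup>2 + 16 * k * s = d\<^sup>2 + 16 * k * d + 16 * k\<^sup>2 + (k\<^sup>2 + 2 * (k * d))"
          by (simp add: s_def power2_eq_square algebra_simps)
        moreover have "0 \<le> k\<^sup>2 + 2 * (k * d)" using k d by simp
        ultimately show ?thesis using q1 q2 unfolding Q_def by linarith
      qed
      have "R * s = 8 * k ^ 3 + d * (19 * k\<^sup>2 + 15 * k * d + 4 * d\<^sup>2)"
        by (simp add: R_def s_def power2_eq_square power3_eq_cube algebra_simps)
      \<comment> \<open>Prepared for the next step, where \<open>d \<ge> 5\<close> gives
        \<open>1 \<le> d - 4\<close> for the cubic term and \<open>d \<le> 5 * (d - 4)\<close> for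
        the rest.\<close>
      also have "\<dots> \<le> 30 * (4 * k ^ 3) + 6 * d * (16 * k\<^sup>2 + 16 * k * d + d\<^sup>2)"
      proof -
        have "0 \<le> 112 * k ^ 3 + d * (77 * k\<^sup>2 + 81 * k * d + 2 * d\<^sup>2)" using k d by simp
        then show ?thesis by (simp add: algebra_simps)
      qed
      also have "\<dots> \<le> 30 * (d - 4) * (4 * k ^ 3) + 30 * (d - 4) * (16 * k\<^sup>2 + 16 * k * d + d\<^sup>2)"
        using k d by (intro add_mono mult_right_mono) auto
      also have "\<dots> = 30 * (d - 4) * (d\<^sup>2 + 16 * k * d + 16 * k\<^sup>2 + 4 * k ^ 3)" by (simp add: algebra_simps)
      also have "\<dots> \<le> 30 * (d - 4) * Q" using Q1 d by (intro mult_left_mono) auto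
      finally show ?thesis .
    qed
    have Q0: "0 \<le> Q" using k s0 by (simp add: Q_def)
    have "k * R * s\<^sup>2 = (k * s) * (R * s)" by (simp add: power2_eq_square)
    also have "\<dots> \<le> (k * s) * (30 * (d - 4) * Q)" using 2 k s0 by (intro mult_left_mono) auto
    also have "\<dots> = (30 * k * s) * ((d - 4) * Q)" by simp
    also have "\<dots> \<le> ((k - 2) * (k - 1) * (s - 2)) * ((d - 4) * Q)"
      using 1 Q0 d by (intro mult_right_mono) auto
    finally have "k * R \<le> (k - 2) * (k - 1) * (s - 2) * ((d - 4) * Q) / s\<^sup>2"
      using s0 by (simp add: pos_le_divide_eq)
    then have "k * R / A \<le> (k - 2) * (k - 1) * (s - 2) * ((d - 4) * Q) / s\<^sup>2 / A"
      using A0 by (intro divide_right_mono) auto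
    also have "\<dots> = k * (k - 2) * Q / s ^ 3 * (s * (d - 4) * (k - 1) * (s - 2) / (k * A))"
      using k s0 A0 by (simp add: divide_simps power2_eq_square power3_eq_cube)
    finally show ?thesis .
  qed
  finally show "1 - w \<le> (m * x + m * (m - 1) / 2 * x\<^sup>2 + m * (m - 1) * (m - 2) / 6 * x ^ 3) * (w - \<theta>)"
    unfolding S diff .
qed

text \<open>For \<open>t \<ge> 2\<close> there is more room: \<open>3 * \<theta> \<le> 2 * w\<close>
  leaves \<open>w - \<theta> \<ge> w / 3\<close>, and the linear and quadratic terms in
  \<open>x\<close> are large enough.\<close>

lemma averaging_inequality_many:
  fixes k d t :: real
  assumes t: "2 \<le> t" "4 * t + 8 \<le> k" "14 * t \<le> d"
  defines "w \<equiv> d * (k + d) * (k + d - 3) / ((2 * k + d - 1) * (2 * k + d - 2) * (2 * k + d - 4))"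
    and "\<theta> \<equiv> t * (k + d) / (k * (2 * k + d - t))" and "x \<equiv> k / (k + d)" and "m \<equiv> k - t - 1"
  shows "1 - w \<le> (m * x + m * (m - 1) / 2 * x\<^sup>2 + m * (m - 1) * (m - 2) / 6 * x ^ 3) * (w - \<theta>)"
    and "\<theta> < w"
proof -
  define n where "n = 2 * k + d"
  define A where "A = (n - 1) * (n - 2) * (n - 4)"
  define s where "s = k + d"
  define R where "R = 8 * k\<^sup>2 + 11 * k * d + 4 * d\<^sup>2"
  have k: "16 \<le> k" and d: "28 \<le> d" using t by auto
  have A0: "0 < A" and s0: "0 < s" and n0: "0 < n" using k d by (auto simp: A_def s_def n_def)
  have w: "w = d * s * (s - 3) / A" by (simp add: w_def A_def s_def n_def)
  have w0: "0 < w" using A0 k d by (simp add: w s_def)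
  have An: "A \<le> n ^ 3"
  proof -
    have "A \<le> n * n * n" unfolding A_def using k d by (intro mult_mono) (auto simp: n_def)
    then show ?thesis by (simp add: power3_eq_cube mult.assoc)
  qed
  have nt: "7 / 8 * n \<le> n - t" using t d by (simp add: n_def)
  have theta: "3 * \<theta> \<le> 2 * w"
  proof -
    have squares: "n\<^sup>2 = 4 * (k * k) + 4 * (k * d) + d * d" "k * (s - 3) = k * k + k * d - 3 * k"
      "d * (s - 3) = k * d + d * d - 3 * d"
      by (simp_all add: n_def s_def power2_eq_square algebra_simps)
    \<comment> \<open>The upper bound on \<open>t\<close> in terms of the smaller parameter is the
      useful one: \<open>d / 14\<close> if \<open>d \<le> 3 * k\<close>, and \<open>k / 4\<close>
      otherwise.\<close>
    have main: "3 * t * n\<^sup>2 \<le> 2 * d * k * (s - 3) * (7 / 8)"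
    proof (cases "d \<le> 3 * k")
      case True
      have "3 / 14 * n\<^sup>2 \<le> 7 / 4 * (k * (s - 3))"
      proof -
        have "d * d \<le> 3 * (k * d)" using mult_right_mono[OF True, of d] d by simp
        moreover have "16 * k \<le> k * k" "0 \<le> k * d" using k d by simp_all
        ultimately show ?thesis using k unfolding squares unfolding distrib_left right_diff_distrib by linarith
      qed
      then have "d * (3 / 14 * n\<^sup>2) \<le> d * (7 / 4 * (k * (s - 3)))" using d by (intro mult_left_mono) auto
      moreover have "14 * t * n\<^sup>2 \<le> d * n\<^sup>2" using t by (intro mult_right_mono) auto
      ultimately show ?thesis by (simp add: algebra_simps)
    next
      case False
      have "3 / 4 * n\<^sup>2 \<le> 7 / 4 * (d * (s - 3))"
      proof -
        have 3: "3 * k \<le> d" using False by simp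
        have "3 * (k * d) \<le> d * d" using mult_right_mono[OF 3, of d] d by simp
        moreover have "3 * (k * k) \<le> k * d" using mult_left_mono[OF 3, of k] k by simp
        moreover have "28 * d \<le> d * d" using d by simp
        ultimately show ?thesis using d unfolding squares unfolding distrib_left right_diff_distrib by linarith
      qed
      then have "k * (3 / 4 * n\<^sup>2) \<le> k * (7 / 4 * (d * (s - 3)))" using k by (intro mult_left_mono) auto
      moreover have "4 * t * n\<^sup>2 \<le> k * n\<^sup>2" using t by (intro mult_right_mono) auto
      ultimately show ?thesis by (simp add: algebra_simps)
    qed
    have "3 * t * A \<le> 3 * t * n ^ 3" using An t by simp
    also have "\<dots> = (3 * t * n\<^sup>2) * n" by (simp add: power2_eq_square power3_eq_cube)
    also have "\<dots> \<le> (2 * d * k * (s - 3) * (7 / 8)) * n" using main n0 by (intro mult_right_mono) auto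
    also have "\<dots> = (2 * d * k * (s - 3)) * (7 / 8 * n)" by simp
    also have "\<dots> \<le> (2 * d * k * (s - 3)) * (n - t)"
      using nt k d by (intro mult_left_mono) (auto simp: s_def)
    finally have *: "3 * t * A \<le> 2 * d * k * (s - 3) * (n - t)" .
    have nt0: "0 < n - t" using nt n0 by linarith
    have "3 * \<theta> = s * (3 * t * A) / (k * (n - t) * A)"
      using A0 by (simp add: \<theta>_def s_def n_def)
    also have "\<dots> \<le> s * (2 * d * k * (s - 3) * (n - t)) / (k * (n - t) * A)"
      using * s0 k nt0 A0 by (intro divide_right_mono mult_left_mono) auto
    also have "\<dots> = 2 * w" using k nt0 A0 by (simp add: w)
    finally show ?thesis .
  qed
  then show "\<theta> < w" using w0 by linarith
  have m: "13 \<le> m" "3 / 4 * k + 1 \<le> m" using t by (auto simp: m_def)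
  have x0: "0 < x" using k s0 by (simp add: x_def s_def)
  let ?S = "m * x + m * (m - 1) / 2 * x\<^sup>2"
  have "1 - w = (A - d * s * (s - 3)) / A" using A0 by (simp add: w diff_divide_distrib)
  also have "\<dots> \<le> k * R / A"
    using gain_complement_upper[of k d] k d A0
    by (intro divide_right_mono) (auto simp: A_def n_def s_def R_def)
  also have "\<dots> \<le> ?S * (w / 3)"
  proof -
    have sq: "9 / 16 * k * k \<le> m * (m - 1)"
    proof -
      have "(3 / 4 * k) * (3 / 4 * k) \<le> m * (m - 1)" using m k by (intro mult_mono) auto
      then show ?thesis by simp
    qed
    have sq': "156 \<le> m * (m - 1)"
    proof -
      have "13 * 12 \<le> m * (m - 1)" using m by (intro mult_mono) auto
      then show ?thesis by simp
    qed
    \<comment> \<open>The constant is \<open>1 - 3 / s\<close> at the least value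
      \<open>s = 16 + 28\<close>.\<close>
    have s3: "41 / 44 * s \<le> s - 3" using k d by (simp add: s_def)
    have 1: "3 * R \<le> (m * s + m * (m - 1) / 2 * k) * d * (41 / 44)"
    proof -
      have "13 * (s * d) \<le> m * (s * d)" using m s0 d by (intro mult_right_mono) auto
      moreover have "156 * (k * d) \<le> m * (m - 1) * (k * d)" using sq' k d by (intro mult_right_mono) auto
      moreover have "9 / 16 * k * k * (k * d) \<le> m * (m - 1) * (k * d)" using sq k d by (intro mult_right_mono) auto
      moreover have "448 * (k * k) \<le> k * k * (k * d)"
      proof -
        have "16 * 28 \<le> k * d" using k d by (intro mult_mono) auto
        then have "k * k * (16 * 28) \<le> k * k * (k * d)" using k by (intro mult_left_mono) auto
        then show ?thesis by simp
      qed
      moreover have "9 / 16 * k * k * (k * d) = 9 / 16 * (k * k * (k * d))" by simp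
      moreover have "0 \<le> k * k" "0 \<le> k * d" "0 \<le> d * d" using k d by simp_all
      moreover have "s * d = k * d + d * d" "3 * R = 24 * (k * k) + 33 * (k * d) + 12 * (d * d)"
        by (simp_all add: s_def R_def power2_eq_square algebra_simps)
      moreover have "(m * s + m * (m - 1) / 2 * k) * d * (41 / 44)
          = 41 / 44 * (m * (s * d)) + 41 / 88 * (m * (m - 1) * (k * d))"
        by (simp add: field_simps)
      ultimately show ?thesis by linarith
    qed
    have "3 * R * s \<le> (m * s + m * (m - 1) / 2 * k) * d * (41 / 44) * s"
      using 1 s0 by (intro mult_right_mono) auto
    also have "\<dots> = (m * s + m * (m - 1) / 2 * k) * d * (41 / 44 * s)" by simp
    also have "\<dots> \<le> (m * s + m * (m - 1) / 2 * k) * d * (s - 3)"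
      using s3 m k d s0 by (intro mult_left_mono) auto
    finally have "R \<le> (m * s + m * (m - 1) / 2 * k) * d * (s - 3) / (3 * s)"
      using s0 by (simp add: pos_le_divide_eq)
    then have "k * R / A \<le> k * ((m * s + m * (m - 1) / 2 * k) * d * (s - 3) / (3 * s)) / A"
      using k A0 by (intro divide_right_mono mult_left_mono) auto
    also have "\<dots> = ?S * (w / 3)"
      using s0 A0 by (simp add: w x_def s_def[symmetric] divide_simps power2_eq_square) (simp add: algebra_simps)
    finally show ?thesis .
  qed
  also have "\<dots> \<le> (?S + m * (m - 1) * (m - 2) / 6 * x ^ 3) * (w - \<theta>)"
    using m x0 w0 theta by (intro mult_mono) auto
  finally show "1 - w \<le> (m * x + m * (m - 1) / 2 * x\<^sup>2 + m * (m - 1) * (m - 2) / 6 * x ^ 3) * (w - \<theta>)" .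
qed

section \<open>From real inequalities back to binomial coefficients\<close>

text \<open>\<open>\<kappa>\<close> is the share of the missing sets that the diversity may consume:
  the ratio \<open>(k - 1) / (n - k - 1)\<close> times the weight \<open>k / (k - t)\<close> of a
  member avoiding \<open>x\<close>. The rest has to cover the subtracted binomial. The product
  identity \<open>id\<close> removes the binomials common to both sides, leaving the powers of
  \<open>power_comparison\<close>.\<close>

lemma missing_sets_suffice:
  fixes n k t :: nat
  assumes par: "(t = 1 \<and> 35 \<le> k \<and> 2 * k + 5 \<le> n) \<or> (2 \<le> t \<and> 4 * t + 8 \<le> k \<and> 2 * k + 14 * t \<le> n)"
  defines "\<kappa> \<equiv> real k * (real k - 1) / ((real k - real t) * (real n - real k - 1))"
  shows "real ((n - t - k - 1) choose (k - t - 1)) * real ((n - 1) choose t)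
      \<le> real ((k - 1) choose t) * (real ((n - k + 2 * t + 1) choose (k - 1)) * (1 - \<kappa>))"
    and "0 < 1 - \<kappa>"
proof -
  let ?N = "real ((n - t - k - 1) choose (k - t - 1))" and ?p = "real ((k - 1) choose t)"
    and ?c = "real ((n - k - 1) choose (k - 1))"
  define d where "d = real n - 2 * real k"
  define a where "a = (real k - 1) / (d + 2 * real t + 2)"
  define b where "b = real k / (real k + d - real t)"
  have kt: "1 \<le> t" "t + 2 \<le> k" "2 * k + t < n" "2 * k + 5 \<le> n" using par by auto
  have par': "(t = 1 \<and> 35 \<le> real k \<and> 5 \<le> d) \<or> (2 \<le> t \<and> 4 * real t + 8 \<le> real k \<and> 14 * real t \<le> d)"
    using par
  proof (elim disjE conjE)
    assume t: "t = 1" "35 \<le> k" "2 * k + 5 \<le> n"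
    have "real (2 * k + 5) \<le> real n" using t by (simp only: of_nat_le_iff)
    then show ?thesis using t by (simp add: d_def)
  next
    assume t: "2 \<le> t" "4 * t + 8 \<le> k" "2 * k + 14 * t \<le> n"
    have "real (2 * k + 14 * t) \<le> real n" "real (4 * t + 8) \<le> real k" using t by (simp_all only: of_nat_le_iff)
    then show ?thesis using t by (simp add: d_def)
  qed
  have kd: "real k + d - 1 = real n - real k - 1" by (simp add: d_def)
  note pc = power_comparison[OF par', unfolded kd, folded \<kappa>_def, folded a_def b_def]
  show k0: "0 < 1 - \<kappa>" by (rule pc(2))
  have M: "(1 + a) ^ (2 * t + 2) * ?c \<le> real ((n - k + 2 * t + 1) choose (k - 1))"
  proof -
    have e: "n - k - 1 + (2 * t + 2) = n - k + 2 * t + 1" using kt by simp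
    have e': "real (n - k + 2 * t + 1 - (k - 1)) = d + 2 * real t + 2" "real (k - 1) = real k - 1"
      using kt by (simp_all add: d_def of_nat_diff)
    have "k - 1 \<le> n - k - 1" using kt by linarith
    from binomial_growth_lower[OF this order_refl, of "2 * t + 2"] show ?thesis unfolding a_def e e' .
  qed
  have B: "real ((n - 1) choose t) \<le> (1 + b) ^ t * real ((n - k - 1) choose t)"
  proof -
    have "n - k - 1 + k = n - 1" "t \<le> n - k - 1" using kt by linarith+
    moreover have "real (n - k - 1) + 1 - real t = real k + d - real t" using kt by (simp add: d_def of_nat_diff)
    ultimately show ?thesis using binomial_shift_upper[of t "n - k - 1" t k] unfolding b_def by simp
  qed
  have id: "?N * real ((n - k - 1) choose t) = ?c * ?p"
  proof -
    have "n - k - 1 - t = n - t - k - 1" "k - 1 - t = k - t - 1" by simp_all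
    then have "((n - k - 1) choose (k - 1)) * ((k - 1) choose t)
        = ((n - k - 1) choose t) * ((n - t - k - 1) choose (k - t - 1))"
      using choose_mult[of t "k - 1" "n - k - 1"] kt by simp
    then show ?thesis by (metis mult.commute of_nat_mult)
  qed
  have "?N * real ((n - 1) choose t) \<le> ?N * ((1 + b) ^ t * real ((n - k - 1) choose t))"
    using B by (intro mult_left_mono) auto
  also have "\<dots> = (1 + b) ^ t * (?c * ?p)" unfolding id[symmetric] by simp
  also have "\<dots> \<le> ((1 + a) ^ (2 * t + 2) * (1 - \<kappa>)) * (?c * ?p)" using pc(1) by (intro mult_right_mono) auto
  also have "\<dots> = (?p * (1 - \<kappa>)) * ((1 + a) ^ (2 * t + 2) * ?c)" by simp
  also have "\<dots> \<le> (?p * (1 - \<kappa>)) * real ((n - k + 2 * t + 1) choose (k - 1))"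
    using M k0 by (intro mult_left_mono) auto
  finally show "?N * real ((n - 1) choose t)
      \<le> ?p * (real ((n - k + 2 * t + 1) choose (k - 1)) * (1 - \<kappa>))" by (simp add: mult_ac)
qed

text \<open>Four steps take the top from \<open>n - 5\<close> to \<open>n - 1\<close>. The resulting
  factors \<open>n - k - 1\<close>, \<open>n - k - 2\<close> and \<open>n - 3\<close> cancel against
  the gain, which leaves the share \<open>w\<close> of the averaging inequalities.\<close>

lemma large_diversity_gain_eq:
  assumes "2 * k < n" "4 \<le> k"
  shows "(1 - real (k - 1) * real (k - 2) / (real (n - k - 1) * real (n - k - 2))) * real ((n - 5) choose (k - 1))
    = (real n - 2 * real k) * (real n - real k) * (real n - real k - 3)
      / ((real n - 1) * (real n - 2) * (real n - 4)) * real ((n - 1) choose (k - 1))"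
proof -
  let ?c = "\<lambda>i. real ((n - i) choose (k - 1))"
  have step: "(real n - real k - i + 1) * ?c i = (real n - real i) * ?c (Suc i)" if "i \<in> {1..4}" for i
  proof -
    have "k - 1 \<le> n - i" "i \<le> n" "1 \<le> k" using that assms by auto
    then show ?thesis using binomial_pred_ratio[of "k - 1" "n - i"] by (simp add: of_nat_diff algebra_simps)
  qed
  define N K where "N = real n" and "K = real k"
  have NK: "4 \<le> K" "2 * K + 1 \<le> N" using assms by (auto simp: N_def K_def)
  have c: "(N - K) * ?c 1 = (N - 1) * ?c 2" "(N - K - 1) * ?c 2 = (N - 2) * ?c 3"
    "(N - K - 2) * ?c 3 = (N - 3) * ?c 4" "(N - K - 3) * ?c 4 = (N - 4) * ?c 5"
    using step[of 1] step[of 2] step[of 3] step[of 4] by (simp_all add: N_def K_def numeral_eq_Suc)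
  have c5: "?c 5 = (N - K) * (N - K - 1) * (N - K - 2) * (N - K - 3)
      / ((N - 1) * (N - 2) * (N - 3) * (N - 4)) * ?c 1"
  proof -
    have "?c 2 = (N - K) / (N - 1) * ?c 1" "?c 3 = (N - K - 1) / (N - 2) * ?c 2"
      "?c 4 = (N - K - 2) / (N - 3) * ?c 3" "?c 5 = (N - K - 3) / (N - 4) * ?c 4"
      using c NK by (simp_all add: field_simps)
    then show ?thesis by (simp add: mult_ac)
  qed
  have r: "real (k - 1) = K - 1" "real (k - 2) = K - 2" "real (n - k - 1) = N - K - 1" "real (n - k - 2) = N - K - 2"
    using assms by (auto simp: N_def K_def of_nat_diff)
  have "1 - (K - 1) * (K - 2) / ((N - K - 1) * (N - K - 2)) = (N - 2 * K) * (N - 3) / ((N - K - 1) * (N - K - 2))"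
  proof -
    have "(N - K - 1) * (N - K - 2) - (K - 1) * (K - 2) = (N - 2 * K) * (N - 3)" by (simp add: algebra_simps)
    moreover have "(N - K - 1) * (N - K - 2) \<noteq> 0" using NK by simp
    ultimately show ?thesis by (metis diff_divide_distrib divide_self)
  qed
  moreover have "(N - 2 * K) * (N - 3) / (u * v) * (p * u * v * q / (x * y * (N - 3) * z) * c)
      = (N - 2 * K) * p * q / (x * y * z) * c" if "u \<noteq> 0" "v \<noteq> 0" for u v p q x y z c :: real
    using that NK by (simp add: divide_simps)
  ultimately show ?thesis unfolding r c5 N_def[symmetric] K_def[symmetric]
    using NK by (simp add: mult.assoc)
qed

text \<open>Everything reduces to \<open>(1 - w) * ?D \<le> (1 - \<theta>) * (?D - ?N)\<close>. The
  factor \<open>1 - \<theta>\<close> is the quotient of \<open>n choose t\<close> by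
  \<open>(n - 1) choose t\<close>, divided by the quotient of \<open>k choose t\<close> by
  \<open>(k - 1) choose t\<close>: it compares averaging over all \<open>t\<close>-sets with
  averaging in a star.\<close>

lemma averaging_inequality:
  fixes n k t :: nat
  assumes par: "(t = 1 \<and> 35 \<le> k \<and> 2 * k + 5 \<le> n) \<or> (2 \<le> t \<and> 4 * t + 8 \<le> k \<and> 2 * k + 14 * t \<le> n)"
    and F: "f + (1 - real (k - 1) * real (k - 2) / (real (n - k - 1) * real (n - k - 2)))
      * real ((n - 5) choose (k - 1)) \<le> real ((n - 1) choose (k - 1))"
  shows "f * real (k choose t) \<le> real (n choose t)
    * (real ((n - t - 1) choose (k - t - 1)) - real ((n - t - k - 1) choose (k - t - 1)))"
proof -
  define N K T d where "N = real n" and "K = real k" and "T = real t" and "d = real n - 2 * real k"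
  define w where "w = (N - 2 * K) * (N - K) * (N - K - 3) / ((N - 1) * (N - 2) * (N - 4))"
  define \<theta> where "\<theta> = T * (N - K) / (K * (N - T))"
  define x where "x = K / (N - K)"
  define m where "m = K - T - 1"
  define S where "S = m * x + m * (m - 1) / 2 * x\<^sup>2 + m * (m - 1) * (m - 2) / 6 * x ^ 3"
  let ?C = "real ((n - 1) choose (k - 1))" and ?D = "real ((n - t - 1) choose (k - t - 1))"
    and ?N = "real ((n - t - k - 1) choose (k - t - 1))"
    and ?p = "real ((k - 1) choose t)" and ?q = "real ((n - 1) choose t)"
  have kt: "1 \<le> t" "t + 2 \<le> k" "2 * k + t < n" "4 \<le> k" "2 * k < n" using par by auto
  have NKT: "1 \<le> T" "T + 2 \<le> K" "2 * K + T < N" using kt by (auto simp: N_def K_def T_def)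
  have key: "1 - w \<le> S * (w - \<theta>) \<and> \<theta> < w"
    using par
  proof (elim disjE conjE)
    assume t: "t = 1" "35 \<le> k" "2 * k + 5 \<le> n"
    have "real (2 * k + 5) \<le> real n" using t by (simp only: of_nat_le_iff)
    then have h: "35 \<le> K" "5 \<le> N - 2 * K" using t by (auto simp: N_def K_def)
    have "T = 1" using t by (simp add: T_def)
    then show ?thesis
      using averaging_inequality_one[OF h] unfolding S_def m_def x_def w_def \<theta>_def by simp
  next
    assume t: "2 \<le> t" "4 * t + 8 \<le> k" "2 * k + 14 * t \<le> n"
    have "real (2 * k + 14 * t) \<le> real n" "real (4 * t + 8) \<le> real k" using t by (simp_all only: of_nat_le_iff)
    then have h: "2 \<le> T" "4 * T + 8 \<le> K" "14 * T \<le> N - 2 * K" using t by (auto simp: N_def K_def T_def)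
    show ?thesis
      using averaging_inequality_many[OF h] unfolding S_def m_def x_def w_def \<theta>_def by simp
  qed
  have ND: "(1 + S) * ?N \<le> ?D"
  proof -
    have x0: "0 \<le> x" using NKT by (simp add: x_def)
    have m': "real (k - t - 1) = m" using kt by (simp add: m_def K_def T_def of_nat_diff)
    have "n - t - k - 1 + k = n - t - 1" using kt by linarith
    moreover have "real (n - t - k - 1) \<le> N - K" using kt by (simp add: N_def K_def of_nat_diff)
    ultimately have "(1 + x) ^ (k - t - 1) * ?N \<le> ?D"
      using binomial_shift_lower[of "k - t - 1" "n - t - k - 1" "N - K" k] kt NKT unfolding x_def K_def by simp
    moreover have "1 + S \<le> (1 + x) ^ (k - t - 1)"
      using power_lower_cubic[OF x0, of "k - t - 1"] unfolding m' S_def by simp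
    then have "(1 + S) * ?N \<le> (1 + x) ^ (k - t - 1) * ?N" by (intro mult_right_mono) auto
    ultimately show ?thesis by linarith
  qed
  \<comment> \<open>Adding \<open>w - \<theta>\<close> to both sides of \<open>key\<close> gives
    \<open>1 - \<theta> \<le> (1 + S) * (w - \<theta>)\<close>.\<close>
  have "(1 - \<theta>) * ?N \<le> ((1 + S) * (w - \<theta>)) * ?N"
    using key by (intro mult_right_mono) (auto simp: algebra_simps)
  also have "\<dots> = (w - \<theta>) * ((1 + S) * ?N)" by simp
  also have "\<dots> \<le> (w - \<theta>) * ?D" using ND key by (intro mult_left_mono) auto
  finally have main: "(1 - w) * ?D \<le> (1 - \<theta>) * (?D - ?N)" by (simp add: algebra_simps)
  have th: "1 - \<theta> = N * (K - T) / (K * (N - T))"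
  proof -
    have "K * (N - T) - T * (N - K) = N * (K - T)" by (simp add: algebra_simps)
    moreover have "K * (N - T) \<noteq> 0" using NKT by simp
    ultimately show ?thesis unfolding \<theta>_def by (metis diff_divide_distrib divide_self)
  qed
  have id: "?C * ?p = ?q * ?D"
  proof -
    have "n - 1 - t = n - t - 1" "k - 1 - t = k - t - 1" by simp_all
    then have "((n - 1) choose (k - 1)) * ((k - 1) choose t) = ((n - 1) choose t) * ((n - t - 1) choose (k - t - 1))"
      using choose_mult[of t "k - 1" "n - 1"] kt by simp
    then show ?thesis by (metis of_nat_mult)
  qed
  have kp: "(K - T) * real (k choose t) = K * ?p"
    using binomial_pred_ratio[of t k] kt by (simp add: K_def T_def)
  have nq: "(N - T) * real (n choose t) = N * ?q"
    using binomial_pred_ratio[of t n] kt by (simp add: N_def T_def)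
  have "f \<le> (1 - w) * ?C"
    using F unfolding large_diversity_gain_eq[OF kt(5,4)] N_def[symmetric] K_def[symmetric] w_def[symmetric]
    by (simp add: algebra_simps)
  then have "f * (K * ?p) \<le> ((1 - w) * ?C) * (K * ?p)" using NKT by (intro mult_right_mono) auto
  also have "\<dots> = K * ((1 - w) * (?C * ?p))" by simp
  also have "\<dots> = K * ?q * ((1 - w) * ?D)" unfolding id by simp
  also have "\<dots> \<le> K * ?q * ((1 - \<theta>) * (?D - ?N))" using main NKT by (intro mult_left_mono) auto
  also have "\<dots> = (K - T) / (N - T) * (N * ?q) * (?D - ?N)" unfolding th using NKT by simp
  also have "\<dots> = (K - T) * (real (n choose t) * (?D - ?N))" unfolding nq[symmetric] using NKT by simp
  finally have "(K - T) * (f * real (k choose t)) \<le> (K - T) * (real (n choose t) * (?D - ?N))"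
    unfolding kp[symmetric] by (simp add: mult_ac)
  then show ?thesis using NKT by (simp add: mult_le_cancel_left)
qed

theorem theorem28:
  fixes n k t :: nat and F :: "nat set set"
  assumes params: "(t = 1 \<and> k \<ge> 35 \<and> n \<ge> 2 * k + 5) \<or>
      (1 < t \<and> real t \<le> real k / 4 - 2 \<and> n \<ge> 2 * k + 14 * t)"
    and uniform: "F \<subseteq> nsets {1..n} k"
    and "intersecting F"
    and "non_trivial F"
  shows "int (min_degree n t F) \<le>
    int ((n - t - 1) choose (k - t - 1)) - int ((n - t - k - 1) choose (k - t - 1))"
proof (rule ccontr)
  let ?D = "(n - t - 1) choose (k - t - 1)" and ?N = "(n - t - k - 1) choose (k - t - 1)"
  assume "\<not> int (min_degree n t F) \<le> int ?D - int ?N"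
  then have large: "?D < min_degree n t F + ?N" by linarith
  have par: "(t = 1 \<and> 35 \<le> k \<and> 2 * k + 5 \<le> n) \<or> (2 \<le> t \<and> 4 * t + 8 \<le> k \<and> 2 * k + 14 * t \<le> n)"
    using params
  proof (elim disjE conjE)
    assume t: "1 < t" "real t \<le> real k / 4 - 2" "2 * k + 14 * t \<le> n"
    then have "real (4 * t + 8) \<le> real k" by simp
    then show ?thesis using t by (simp only: of_nat_le_iff) simp
  qed simp
  have kt: "1 \<le> t" "t + 2 \<le> k" "2 * k + t < n" "4 \<le> k" "2 * k < n" "t < k" using par by auto
  have X: "finite {1..n}" "card {1..n} = n" by auto
  have deg: "?D < set_degree F S + ?N" if "S \<in> nsets {1..n} t" for S
  proof -
    have "min_degree n t F \<le> set_degree F S"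
      unfolding min_degree_def using that by (intro Min_le) (auto simp: finite_imp_finite_nsets)
    then show ?thesis using large by linarith
  qed
  have "(n - 3) choose (k - 2) \<le> misses F x" if x: "x \<in> {1..n}" for x
  proof (rule ccontr)
    assume low: "\<not> (n - 3) choose (k - 2) \<le> misses F x"
    let ?M0 = "(n - k + 2 * t + 1) choose (k - 1)" and ?C = "real ((n - 1) choose (k - 1))"
      and ?p = "real ((k - 1) choose t)" and ?q = "real ((n - 1) choose t)"
    define M where "M = ?C - real (hits F x)"
    define \<kappa> where "\<kappa> = real k * (real k - 1) / ((real k - real t) * (real n - real k - 1))"
    have finF: "finite F" using finite_subset_nsets[OF X(1) uniform] .
    obtain A where "A \<in> F" "x \<notin> A" using \<open>non_trivial F\<close> unfolding non_trivial_def by blast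
    then have "{A \<in> F. x \<notin> A} \<noteq> {}" by blast
    then have pos: "1 \<le> misses F x" unfolding misses_def using finF by (simp add: Suc_le_eq card_gt_0_iff)
    have "\<not> misses F x \<le> (n - t - k - 2) choose (k - t - 2)"
    proof
      assume "misses F x \<le> (n - t - k - 2) choose (k - t - 2)"
      then obtain S where "S \<in> nsets {1..n} t" "set_degree F S + ?N \<le> ?D"
        using small_diversity_low_degree[OF uniform X \<open>intersecting F\<close> x kt(1,2) _ pos] kt(3) by auto
      then show False using deg[of S] by linarith
    qed
    then have "(n - k + 2 * t + 1) choose (2 * t + 2) \<le> misses F x" using diversity_threshold[OF par] by linarith
    \<comment> \<open>Symmetry expresses the threshold through \<open>n - 1 - k\<close>, the size of
      the complement of a member within the ground set without \<open>x\<close>.\<close>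
    moreover have "(n - k + 2 * t + 1) choose (2 * t + 2) = (n - k + 2 * t + 1) choose (n - 1 - k)"
      using kt by (subst binomial_symmetric) (auto intro: arg_cong2[where f = "(choose)"])
    ultimately have "?M0 + hits F x \<le> (n - 1) choose (k - 1)"
      using star_bounds(2)[OF uniform X \<open>intersecting F\<close> x, of "n - k + 2 * t + 1"] kt by simp
    then have M0: "real ?M0 \<le> M" unfolding M_def by linarith
    have ratio: "(real n - real k - 1) * misses F x \<le> (real k - 1) * M"
      using star_ratio_two[OF uniform X \<open>intersecting F\<close> x kt(5)] low kt
      by (simp add: M_def of_nat_diff algebra_simps)
    have r: "0 < real k - real t" "0 < real n - real k - 1" "0 < real k - 1"
      using kt by auto
    have kp: "(real k - real t) * real (k choose t) = real k * ?p"
      using binomial_pred_ratio[of t k] kt by simp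
    have "real (misses F x) * real (k choose t) \<le> ?p * (\<kappa> * M)"
    proof -
      have "(real k - real t) * ((real n - real k - 1) * (real (misses F x) * real (k choose t)))
          = (real k * ?p) * ((real n - real k - 1) * misses F x)"
        unfolding kp[symmetric] by simp
      also have "\<dots> \<le> (real k * ?p) * ((real k - 1) * M)" using ratio by (intro mult_left_mono) auto
      finally have "((real k - real t) * (real n - real k - 1)) * (real (misses F x) * real (k choose t))
          \<le> (real k * ?p) * ((real k - 1) * M)" by (simp add: mult.assoc)
      then have "real (misses F x) * real (k choose t)
          \<le> (real k * ?p) * ((real k - 1) * M) / ((real k - real t) * (real n - real k - 1))"
        using r by (simp add: pos_le_divide_eq mult.commute)
      also have "\<dots> = ?p * (\<kappa> * M)" unfolding \<kappa>_def by simp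
      finally show ?thesis .
    qed
    moreover have "?q * real ?N \<le> ?p * (M * (1 - \<kappa>))"
    proof -
      note suff = missing_sets_suffice[OF par, folded \<kappa>_def]
      have "?p * (real ?M0 * (1 - \<kappa>)) \<le> ?p * (M * (1 - \<kappa>))"
        using M0 suff(2) by (intro mult_left_mono mult_right_mono) auto
      then show ?thesis using suff(1) by (simp add: mult.commute)
    qed
    moreover have "?q * real ?D = ?C * ?p"
    proof -
      have "n - 1 - t = n - t - 1" "k - 1 - t = k - t - 1" by simp_all
      then have "((n - 1) choose (k - 1)) * ((k - 1) choose t) = ((n - 1) choose t) * ?D"
        using choose_mult[of t "k - 1" "n - 1"] kt by simp
      then show ?thesis by (metis of_nat_mult)
    qed
    moreover have "?q * real ?D < real (misses F x) * real (k choose t) + real (hits F x) * ?p + ?q * real ?N"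
    proof -
      have "((n - 1) choose t) * ?D
          < misses F x * (k choose t) + hits F x * ((k - 1) choose t) + ((n - 1) choose t) * ?N"
        using kt deg by (intro average_degree_avoiding[OF uniform X x]) auto
      then have "real (((n - 1) choose t) * ?D)
          < real (misses F x * (k choose t) + hits F x * ((k - 1) choose t) + ((n - 1) choose t) * ?N)"
        by (simp only: of_nat_less_iff)
      then show ?thesis by (simp only: of_nat_add of_nat_mult)
    qed
    \<comment> \<open>The two shares \<open>\<kappa> * M\<close> and
      \<open>M * (1 - \<kappa>)\<close> restore \<open>M = ?C - hits F x\<close>, so the right side
      collapses to the left one.\<close>
    ultimately have "?C * ?p < ?p * (\<kappa> * M) + real (hits F x) * ?p + ?p * (M * (1 - \<kappa>))" by linarith
    also have "\<dots> = ?C * ?p" by (simp add: M_def algebra_simps)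
    finally show False by simp
  qed
  from large_diversity_bound[OF uniform \<open>intersecting F\<close> kt(5,4) this]
  have "real (card F) * real (k choose t) \<le> real (n choose t) * (real ?D - real ?N)"
    by (intro averaging_inequality[OF par]) auto
  moreover have "(n choose t) * ?D < card F * (k choose t) + (n choose t) * ?N"
    using kt deg by (intro average_degree[OF uniform X]) auto
  then have "real ((n choose t) * ?D) < real (card F * (k choose t) + (n choose t) * ?N)"
    by (simp only: of_nat_less_iff)
  ultimately show False by (simp add: right_diff_distrib)
qed

end
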